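(* Let $\theta_0=(\mathbf W_0,\sigma_0^2)\in\Theta$ be the true parameter and let $X_1,X_2,\ldots$ be i.i.d. random vectors in $\mathbb R^p$ with density $f(\cdot;\theta_0)$. Let $\theta_n$ denote the sequence of maximum likelihood estimates of the PPCA model, $\theta_n$ being based on $X_1,\ldots,X_n$. Then $$\mathbb P\left(\lim_{n}[\theta_n]=[\theta_0]\right)=1,$$ i.e. the maximum likelihood estimates converge to the true parameter $\theta_0$ almost surely, and therefore in probability, in the quotient space $\Theta/C$.
   Context: Let $p>q$ be positive integers, $\mathbb R_+=(0,\infty)$, and $\Theta=\{\theta=(\mathbf W_\theta,\sigma_\theta^2)\in\mathbb R^{p\times q}\times\mathbb R_+\}$, viewed as a subset of $\mathbb R^{pq+1}$ with the Euclidean metric $d$. The probabilistic PCA (PPCA) model is $x=\mathbf Wz+\varepsilon$ with independent $z\sim\mathcal N(0,I_q)$ and $\varepsilon\sim\mathcal N(0,\sigma^2I_p)$. For $\theta\in\Theta$, $f(\cdot;\theta)$ is the resulting marginal density of $x$ on $\mathbb R^p$, that of $\mathcal N(0,\mathbf W_\theta\mathbf W_\theta^T+\sigma_\theta^2 I_p)$. Let $C=\{\theta\in\Theta:\mathbf W_\theta\mathbf W_\theta^T+\sigma_\theta^2I_p=\mathbf W_0\mathbf W_0^T+\sigma_0^2I_p\}$, a closed subset of $\Theta$. $\Theta/C$ is the quotient of $\Theta$ by the equivalence relation $\theta\sim\phi$ iff $\theta=\phi$ or $\theta,\phi\in C$; $[\theta]$ denotes the class of $\theta$. It carries the metric $\bar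 d([\theta],[\phi])=\min\big(d(\theta,\phi),\,d(\theta,C)+d(\phi,C)\big)$, where $d(\theta,C)=\inf_{c\in C}d(\theta,c)$. Convergence in $\Theta/C$ is with respect to $\bar d$. $\mathbb P$ is the probability under $\theta_0$. A maximum likelihood estimate $\theta_n=(\widehat{\mathbf W},\widehat\sigma^2)$ of the PPCA model based on $X_1,\ldots,X_n$ is a maximizer of $\theta\mapsto\prod_{i=1}^n f(X_i;\theta)$ over $\Theta$. It is not unique: with $\delta_1\ge\dots\ge\delta_p$ the eigenvalues of the sample covariance matrix $\frac1n\sum_{i=1}^n X_iX_i^T$, the estimates are $\widehat\sigma^2=\frac1{p-q}\sum_{j=q+1}^p\delta_j$ and $\widehat{\mathbf W}=\mathbf U(\mathrm{diag}(\delta_1,\ldots,\delta_q)-\widehat\sigma^2I_q)^{1/2}\mathbf R$, where the columns of $\mathbf U$ are the first $q$ (orthonormal) eigenvectors, for $\delta_1,\ldots,\delta_q$, and $\mathbf R$ is any $q\times q$ orthogonal matrix. *)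

theory Defs
  imports "HOL-Probability.Probability"
begin

section \<open>The probabilistic PCA model\<close>

text \<open>Density of the \<open>k\<close>-variate normal law with mean \<open>\<mu>\<close> and covariance matrix \<open>S\<close>
  (positive definite), with \<open>k = CARD('k)\<close>.\<close>

definition mvn_density :: "real^'k \<Rightarrow> real^'k^'k \<Rightarrow> real^'k \<Rightarrow> real" where
  "mvn_density \<mu> S x =
     exp (- ((x - \<mu>) \<bullet> (matrix_inv S *v (x - \<mu>))) / 2) / sqrt ((2 * pi) ^ CARD('k) * det S)"

text \<open>A parameter is a pair \<open>(W, s)\<close> of a \<open>p \<times> q\<close> matrix \<open>W\<close> and the variance \<open>s\<close>
  (that is, \<open>\<sigma>\<^sup>2\<close>, not \<open>\<sigma>\<close>). The distance \<^const>\<open>dist\<close> on this product type is the Euclidean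
  distance of \<open>pq + 1\<close> coordinates.\<close>

definition ppca_params :: "((real^'q^'p) \<times> real) set" where
  "ppca_params = {(W, s). s > 0}"

definition ppca_cov :: "(real^'q^'p) \<times> real \<Rightarrow> real^'p^'p" where
  "ppca_cov \<theta> = fst \<theta> ** transpose (fst \<theta>) + snd \<theta> *\<^sub>R mat 1"

definition ppca_density :: "(real^'q^'p) \<times> real \<Rightarrow> real^'p \<Rightarrow> real" where
  "ppca_density \<theta> = mvn_density 0 (ppca_cov \<theta>)"

definition ppca_likelihood :: "(nat \<Rightarrow> real^'p) \<Rightarrow> nat \<Rightarrow> (real^'q^'p) \<times> real \<Rightarrow> real" where
  "ppca_likelihood x n \<theta> = (\<Prod>i=1..n. ppca_density \<theta> (x i))"

text \<open>Maximum likelihood estimates from the observations \<open>x 1, \<dots>, x n\<close>. They are never unique if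
  they exist with \<open>W \<noteq> 0\<close>, and they do not exist for \<open>1 \<le> n \<le> q\<close>, where the likelihood is
  unbounded.\<close>

definition is_ppca_mle :: "(nat \<Rightarrow> real^'p) \<Rightarrow> nat \<Rightarrow> (real^'q^'p) \<times> real \<Rightarrow> bool" where
  "is_ppca_mle x n \<theta> \<longleftrightarrow>
     \<theta> \<in> ppca_params \<and>
     (\<forall>\<phi> :: (real^'q^'p) \<times> real. \<phi> \<in> ppca_params \<longrightarrow> ppca_likelihood x n \<phi> \<le> ppca_likelihood x n \<theta>)"

definition ppca_fiber :: "(real^'q^'p) \<times> real \<Rightarrow> ((real^'q^'p) \<times> real) set" where
  "ppca_fiber \<theta>\<^sub>0 = {\<theta> \<in> ppca_params. ppca_cov \<theta> = ppca_cov \<theta>\<^sub>0}"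


section \<open>Collapsing a closed subset of a metric space to a point\<close>

definition collapse_rel :: "'a set \<Rightarrow> 'a set \<Rightarrow> ('a \<times> 'a) set" where
  "collapse_rel T C = {(x, y) \<in> T \<times> T. x = y \<or> (x \<in> C \<and> y \<in> C)}"

abbreviation collapse_class :: "'a set \<Rightarrow> 'a set \<Rightarrow> 'a \<Rightarrow> 'a set" where
  "collapse_class T C x \<equiv> collapse_rel T C `` {x}"

definition collapse_dist :: "'a::metric_space set \<Rightarrow> 'a set \<Rightarrow> 'a set \<Rightarrow> real" where
  "collapse_dist C A B =
     (let x = (SOME x. x \<in> A); y = (SOME y. y \<in> B)
      in min (dist x y) (infdist x C + infdist y C))"

abbreviation collapse_topology :: "'a::metric_space set \<Rightarrow> 'a set \<Rightarrow> 'a set topology" where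
  "collapse_topology T C \<equiv> Metric_space.mtopology (T // collapse_rel T C) (collapse_dist C)"

lemma equiv_collapse_rel: "C \<subseteq> T \<Longrightarrow> equiv T (collapse_rel T C)"
  by (rule equivI) (auto simp: collapse_rel_def refl_on_def sym_def trans_def)

lemma collapse_class_eq:
  "C \<subseteq> T \<Longrightarrow> x \<in> T \<Longrightarrow> collapse_class T C x = (if x \<in> C then C else {x})"
  by (auto simp: collapse_rel_def)

text \<open>Independence of the representatives chosen in \<^const>\<open>collapse_dist\<close>.\<close>

lemma collapse_dist_class:
  fixes C T :: "'a::metric_space set"
  assumes "C \<subseteq> T" "x \<in> T" "y \<in> T"
  shows "collapse_dist C (collapse_class T C x) (collapse_class T C y)
       = min (dist x y) (infdist x C + infdist y C)"
proof -
  define a where "a = (SOME z. z \<in> collapse_class T C x)"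
  define b where "b = (SOME z. z \<in> collapse_class T C y)"
  have a: "a = x \<or> (a \<in> C \<and> x \<in> C)"
    using someI[of "\<lambda>z. z \<in> collapse_class T C x" x] assms
    by (auto simp: a_def collapse_rel_def)
  have b: "b = y \<or> (b \<in> C \<and> y \<in> C)"
    using someI[of "\<lambda>z. z \<in> collapse_class T C y" y] assms
    by (auto simp: b_def collapse_rel_def)
  have *: "min (dist u v) (infdist u C + infdist v C) = infdist v C" if "u \<in> C" for u v
    using infdist_le[OF that, of v] that by (simp add: dist_commute)
  have **: "min (dist u v) (infdist u C + infdist v C) = infdist u C" if "v \<in> C" for u v
    using infdist_le[OF that, of u] that by (simp add: dist_commute)
  have "min (dist a b) (infdist a C + infdist b C) = min (dist x y) (infdist x C + infdist y C)"
    using a b * ** by metis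
  then show ?thesis
    by (simp add: collapse_dist_def Let_def a_def b_def)
qed

lemma Metric_space_collapse:
  fixes C T :: "'a::metric_space set"
  assumes "closedin (top_of_set T) C" "C \<noteq> {}"
  shows "Metric_space (T // collapse_rel T C) (collapse_dist C)"
proof
  have CT: "C \<subseteq> T" using assms(1) closedin_subset by fastforce
  show "0 \<le> collapse_dist C A B" for A B
    by (simp add: collapse_dist_def Let_def infdist_nonneg)
  show "collapse_dist C A B = collapse_dist C B A" for A B
    by (simp add: collapse_dist_def Let_def dist_commute add.commute)
  show "collapse_dist C A B = 0 \<longleftrightarrow> A = B"
    if AB: "A \<in> T // collapse_rel T C" "B \<in> T // collapse_rel T C" for A B
  proof -
    obtain x where x: "x \<in> T" "A = collapse_class T C x"
      using AB(1) by (rule quotientE)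
    obtain y where y: "y \<in> T" "B = collapse_class T C y"
      using AB(2) by (rule quotientE)
    note xy = x(1) y(1) x(2) y(2)
    have inC: "z \<in> C \<longleftrightarrow> infdist z C = 0" if "z \<in> T" for z
    proof -
      obtain K where "closed K" "C = T \<inter> K" using assms(1) by (auto simp: closedin_closed)
      then have "z \<in> C" if "z \<in> closure C"
        using \<open>z \<in> T\<close> that closure_minimal[of C K] by auto
      then have "z \<in> closure C \<longleftrightarrow> z \<in> C"
        using closure_subset by auto
      then show ?thesis using that assms(2) in_closure_iff_infdist_zero by blast
    qed
    have "collapse_dist C A B = 0 \<longleftrightarrow> x = y \<or> (infdist x C = 0 \<and> infdist y C = 0)"
      using infdist_nonneg[of x C] infdist_nonneg[of y C] zero_le_dist[of x y] dist_eq_0_iff[of x y]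
      unfolding xy(3,4) collapse_dist_class[OF CT xy(1,2)] by linarith
    also have "\<dots> \<longleftrightarrow> A = B"
      using inC[OF xy(1)] inC[OF xy(2)] xy(1,2) CT
      unfolding xy(3,4) by (cases "x \<in> C"; cases "y \<in> C") (auto simp: collapse_class_eq)
    finally show ?thesis .
  qed
  show "collapse_dist C A B \<le> collapse_dist C A D + collapse_dist C D B"
    if ADB: "A \<in> T // collapse_rel T C" "D \<in> T // collapse_rel T C" "B \<in> T // collapse_rel T C"
    for A D B
  proof -
    obtain x where x: "x \<in> T" "A = collapse_class T C x"
      using ADB(1) by (rule quotientE)
    obtain y where y: "y \<in> T" "D = collapse_class T C y"
      using ADB(2) by (rule quotientE)
    obtain z where z: "z \<in> T" "B = collapse_class T C z"
      using ADB(3) by (rule quotientE)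
    have "infdist x C \<le> infdist y C + dist x y" "infdist z C \<le> infdist y C + dist z y"
      "infdist x C \<ge> 0" "infdist y C \<ge> 0" "infdist z C \<ge> 0" "dist x z \<le> dist x y + dist y z"
      using infdist_triangle[of x C y] infdist_triangle[of z C y] dist_triangle[of x z y]
      by (auto simp: infdist_nonneg)
    then have "min (dist x z) (infdist x C + infdist z C)
        \<le> min (dist x y) (infdist x C + infdist y C) + min (dist y z) (infdist y C + infdist z C)"
      unfolding dist_commute[of z y] by linarith
    then show ?thesis
      by (simp only: x y z collapse_dist_class[OF CT])
  qed
qed

lemma Metric_space_ppca_quotient:
  fixes \<theta>\<^sub>0 :: "(real^'q^'p) \<times> real"
  assumes "\<theta>\<^sub>0 \<in> ppca_params"
  shows "Metric_space (ppca_params // collapse_rel ppca_params (ppca_fiber \<theta>\<^sub>0))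
           (collapse_dist (ppca_fiber \<theta>\<^sub>0))"
proof (rule Metric_space_collapse)
  have eq: "ppca_cov = (\<lambda>\<theta>::(real^'q^'p) \<times> real.
      \<chi> i j. (\<Sum>k\<in>UNIV. fst \<theta> $ i $ k * fst \<theta> $ j $ k) + snd \<theta> * (if i = j then 1 else 0))"
    by (auto simp: fun_eq_iff ppca_cov_def vec_eq_iff matrix_matrix_mult_def transpose_def mat_def)
  have "continuous_on UNIV (ppca_cov :: (real^'q^'p) \<times> real \<Rightarrow> _)"
    by (subst eq) (intro continuous_intros)
  then have "closed ((ppca_cov :: (real^'q^'p) \<times> real \<Rightarrow> _) -` {ppca_cov \<theta>\<^sub>0})"
    by (intro closed_vimage closed_singleton)
  moreover have "ppca_fiber \<theta>\<^sub>0 = ppca_params \<inter> ppca_cov -` {ppca_cov \<theta>\<^sub>0}"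
    by (auto simp: ppca_fiber_def)
  ultimately show "closedin (top_of_set ppca_params) (ppca_fiber \<theta>\<^sub>0)"
    by (metis closedin_closed)
  show "ppca_fiber \<theta>\<^sub>0 \<noteq> {}"
    using assms unfolding ppca_fiber_def by blast
qed

end

theory Submission
  imports Defs "HOL-Real_Asymp.Real_Asymp"
begin

text \<open>The likelihood of \<open>n\<close> observations is a decreasing function of
  \<open>ln (det \<Sigma>) + trace (\<Sigma>\<^sup>-\<^sup>1 ** S)\<close>, where \<open>S\<close> is the second-moment matrix of the data. At
  \<open>S = \<Sigma>\<^sub>0\<close> the minimum is attained exactly on the fibre of \<open>\<theta>\<^sub>0\<close>. Sublevel sets are compact, uniformly
  for \<open>S\<close> near \<open>\<Sigma>\<^sub>0\<close>, so for every \<open>\<epsilon> > 0\<close> there is \<open>\<delta> > 0\<close> such that, for all \<open>S\<close> within \<open>\<delta>\<close> of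
  \<open>\<Sigma>\<^sub>0\<close>, minimisers exist and all lie within \<open>\<epsilon>\<close> of the fibre. The strong law for the entries of
  \<open>S\<close> then gives almost sure convergence. It comes in the summable form \<open>\<Sum>n. P(|S - \<Sigma>\<^sub>0| \<ge> \<delta>) < \<infinity>\<close>,
  which also bounds the outer probabilities, since \<open>|S - \<Sigma>\<^sub>0| \<ge> \<delta>\<close> is a measurable event, unlike the
  event about the arbitrary selection \<open>\<theta> n\<close>.\<close>

section \<open>Positive definite matrices and Gaussian cross entropy\<close>

text \<open>The loss is, up to additive constants and scaling, the cross entropy of two centred
  Gaussian laws, so its strict minimality on the fibre is positivity of the Kullback-Leibler
  divergence. Two obstacles shape the rest. The parameter space is open and unbounded, and for few
  observations the likelihood has no maximiser; \<open>\<theta> n\<close> is therefore constrained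
  only when a maximiser exists, and its existence has to be derived from a compactness that is
  uniform over all second-moment matrices whose quadratic form has a common lower bound. The
  spectral theorem supplies it, by bounding the loss below by a sum of scalar terms
  \<open>ln d + c / d\<close> over the eigenvalues \<open>d\<close> of the model covariance. The
  other obstacle is summability: second moments bound the deviation probabilities only by order
  \<open>1/n\<close>, fourth moments by order \<open>1/n^2\<close>. The averaged variables are
  products of two Gaussian coordinates, so this costs eighth Gaussian moments, which come from the
  moment generating function.\<close>

lemma matrix_inv_unique:
  fixes A B :: "real^'n^'n"
  assumes "A ** B = mat 1"
  shows "matrix_inv A = B"
proof -
  have "\<exists>A'. A ** A' = mat 1 \<and> A' ** A = mat 1"
    using assms matrix_left_right_inverse by blast
  then have "A ** matrix_inv A = mat 1 \<and> matrix_inv A ** A = mat 1"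
    unfolding matrix_inv_def by (rule someI_ex)
  then show ?thesis
    by (metis assms matrix_mul_assoc matrix_mul_lid matrix_mul_rid)
qed

lemma matrix_inv_mult_right:
  fixes A :: "real^'n^'n"
  assumes "det A \<noteq> 0"
  shows "A ** matrix_inv A = mat 1"
proof -
  obtain B where "A ** B = mat 1"
    using assms invertible_det_nz invertible_right_inverse by blast
  then show ?thesis using matrix_inv_unique by metis
qed

section \<open>Spectral theorem for real symmetric matrices\<close>

lemma mult_matrix_vector_inner:
  fixes A :: "real^'n^'m"
  shows "x \<bullet> (A *v y) = (transpose A *v x) \<bullet> y"
  by (simp add: dot_lmul_matrix)

text \<open>Rayleigh quotient argument: the orthogonal complement \<open>V\<close> of
  \<open>B\<close> is nonzero by dimension and invariant under \<open>A\<close>, because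
  \<open>A\<close> is self-adjoint and \<open>B\<close> consists of eigenvectors. A maximiser of the
  quadratic form on the unit sphere of \<open>V\<close> is an eigenvector, with the maximum as
  eigenvalue.\<close>

lemma symmetric_eigenvector_orthogonal:
  fixes A :: "real^'n^'n" and B :: "(real^'n) set"
  assumes sym: "transpose A = A"
    and B: "finite B" "card B < CARD('n)" "\<And>b. b \<in> B \<Longrightarrow> \<exists>c. A *v b = c *\<^sub>R b"
  obtains v \<mu> where "norm v = 1" "\<And>b. b \<in> B \<Longrightarrow> v \<bullet> b = 0" "A *v v = \<mu> *\<^sub>R v"
proof -
  define V where "V = {x. \<forall>b\<in>B. x \<bullet> b = 0}"
  have selfadj: "x \<bullet> (A *v y) = (A *v x) \<bullet> y" for x y
    using mult_matrix_vector_inner[of x A y] sym by simp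
  have "dim B \<le> card B" using B(1) by (simp add: dim_le_card')
  then have "dim B < DIM(real^'n)" using B(2) by simp
  then obtain w where w: "w \<noteq> 0" "\<And>x. x \<in> span B \<Longrightarrow> orthogonal w x"
    using orthogonal_to_subspace_exists by blast
  have V_iff: "x \<in> V \<longleftrightarrow> (\<forall>b\<in>B. x \<bullet> b = 0)" for x by (simp add: V_def)
  have V_add: "x + y \<in> V" if "x \<in> V" "y \<in> V" for x y
    using that by (simp add: V_iff inner_add_left)
  have V_scale: "c *\<^sub>R x \<in> V" if "x \<in> V" for c x
    using that by (simp add: V_iff)
  have V_A: "A *v x \<in> V" if "x \<in> V" for x
    unfolding V_iff
  proof
    fix b assume "b \<in> B"
    then obtain c where "A *v b = c *\<^sub>R b" using B(3) by blast
    then have "(A *v x) \<bullet> b = c * (x \<bullet> b)" using selfadj[of x b] by simp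
    then show "(A *v x) \<bullet> b = 0" using that \<open>b \<in> B\<close> by (simp add: V_iff)
  qed
  have "closed V"
  proof -
    have "V = (\<Inter>b\<in>B. {x. b \<bullet> x = 0})" by (auto simp: V_def inner_commute)
    then show ?thesis by (auto intro: closed_hyperplane)
  qed
  then have "compact (V \<inter> sphere 0 1)" by (simp add: closed_Int_compact)
  moreover have "w /\<^sub>R norm w \<in> V \<inter> sphere 0 1"
    using w by (auto simp: V_iff orthogonal_def span_base)
  moreover have "continuous_on (V \<inter> sphere 0 1) (\<lambda>x. x \<bullet> (A *v x))"
    by (intro continuous_intros)
  ultimately obtain v where v: "v \<in> V \<inter> sphere 0 1"
    and vmax: "\<And>x. x \<in> V \<inter> sphere 0 1 \<Longrightarrow> x \<bullet> (A *v x) \<le> v \<bullet> (A *v v)"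
    using continuous_attains_sup[of "V \<inter> sphere 0 1" "\<lambda>x. x \<bullet> (A *v x)"] by blast
  define \<mu> where "\<mu> = v \<bullet> (A *v v)"
  have vv: "v \<bullet> v = 1" "v \<in> V" using v by (auto simp: norm_eq_1)
  have quad: "x \<bullet> (A *v x) \<le> \<mu> * (x \<bullet> x)" if "x \<in> V" for x
  proof (cases "x = 0")
    case False
    have "x /\<^sub>R norm x \<in> V \<inter> sphere 0 1" using V_scale[OF that] False by simp
    from vmax[OF this] have "(x /\<^sub>R norm x) \<bullet> (A *v (x /\<^sub>R norm x)) \<le> \<mu>"
      by (simp add: \<mu>_def)
    also have "(x /\<^sub>R norm x) \<bullet> (A *v (x /\<^sub>R norm x)) = (x \<bullet> (A *v x)) / (x \<bullet> x)"
      using False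
      by (simp add: matrix_vector_mult_scaleR power2_norm_eq_inner[symmetric] power2_eq_square
          divide_inverse)
    finally show ?thesis using False by (simp add: divide_le_eq)
  qed simp
  \<comment> \<open>The residual \<open>u\<close> stays in \<open>V\<close> by invariance, so
    \<open>v\<close> may be perturbed along it. Comparing the first-order terms in \<open>t\<close>
    of the maximality inequality at \<open>v + t *\<^sub>R u\<close> forces \<open>u\<close> to
    vanish.\<close>
  define u where "u = A *v v - \<mu> *\<^sub>R v"
  have uV: "u \<in> V" using V_add[OF V_A[OF vv(2)] V_scale[OF vv(2), of "- \<mu>"]] by (simp add: u_def)
  define r where "r = \<mu> * (u \<bullet> u) - u \<bullet> (A *v u)"
  have "2 * t * (u \<bullet> u) \<le> t\<^sup>2 * r" for t
  proof -
    have "(v + t *\<^sub>R u) \<bullet> (A *v (v + t *\<^sub>R u)) \<le> \<mu> * ((v + t *\<^sub>R u) \<bullet> (v + t *\<^sub>R u))"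
      by (intro quad V_add V_scale vv uV)
    moreover have "(v + t *\<^sub>R u) \<bullet> (A *v (v + t *\<^sub>R u))
        = \<mu> + 2 * t * (u \<bullet> (A *v v)) + t\<^sup>2 * (u \<bullet> (A *v u))"
      by (simp add: matrix_vector_right_distrib matrix_vector_mult_scaleR inner_add_left
          inner_add_right \<mu>_def[symmetric] selfadj[of v u] inner_commute power2_eq_square algebra_simps)
    moreover have "\<mu> * ((v + t *\<^sub>R u) \<bullet> (v + t *\<^sub>R u)) = \<mu> + 2 * t * (\<mu> * (u \<bullet> v)) + t\<^sup>2 * (\<mu> * (u \<bullet> u))"
      by (simp add: inner_add_left inner_add_right vv inner_commute power2_eq_square algebra_simps)
    moreover have "u \<bullet> (A *v v) = u \<bullet> u + \<mu> * (u \<bullet> v)"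
      by (metis add.commute diff_add_cancel inner_add_right inner_scaleR_right u_def)
    ultimately show ?thesis by (simp add: r_def algebra_simps)
  qed
  note ineq = this
  have "u \<bullet> u = 0"
  proof (rule ccontr)
    assume "u \<bullet> u \<noteq> 0"
    then have pos: "u \<bullet> u > 0" using inner_ge_zero[of u] by linarith
    \<comment> \<open>Small enough that the quadratic term \<open>t\<^sup>2 * r\<close> is at most
      \<open>t * (u \<bullet> u)\<close>, half of the linear term; the \<open>+ 1\<close> avoids
      division by zero.\<close>
    define t where "t = (u \<bullet> u) / (\<bar>r\<bar> + 1)"
    have t: "t > 0" "t * (\<bar>r\<bar> + 1) = u \<bullet> u" using pos by (simp_all add: t_def)
    have "t\<^sup>2 * r \<le> t\<^sup>2 * (\<bar>r\<bar> + 1)" by (intro mult_left_mono) auto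
    also have "\<dots> = t * (u \<bullet> u)" using t(2) by (simp add: power2_eq_square)
    also have "\<dots> < 2 * t * (u \<bullet> u)" using t(1) pos by simp
    finally show False using ineq[of t] by simp
  qed
  then have "A *v v = \<mu> *\<^sub>R v" by (simp add: u_def)
  then show ?thesis using that[of v \<mu>] vv v by (auto simp: V_iff)
qed

text \<open>Orthonormal sets of eigenvectors grow one vector at a time until they have
  \<open>CARD('n)\<close> elements; a bijection with the index type then lists the set as the
  columns of \<open>Q\<close>.\<close>

lemma symmetric_eigenbasis:
  fixes A :: "real^'n^'n"
  assumes sym: "transpose A = A"
  obtains Q :: "real^'n^'n" and d where "orthogonal_matrix Q" "\<And>i. A *v column i Q = d i *\<^sub>R column i Q"
proof -
  have "\<exists>B::(real^'n) set. finite B \<and> card B = k \<and> pairwise orthogonal B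
      \<and> (\<forall>b\<in>B. norm b = 1 \<and> (\<exists>c. A *v b = c *\<^sub>R b))" if "k \<le> CARD('n)" for k
    using that
  proof (induction k)
    case 0
    show ?case by (intro exI[of _ "{}"]) auto
  next
    case (Suc k)
    then obtain B :: "(real^'n) set" where B: "finite B" "card B = k" "pairwise orthogonal B"
      "\<forall>b\<in>B. norm b = 1 \<and> (\<exists>c. A *v b = c *\<^sub>R b)" by auto
    obtain v \<mu> where v: "norm v = 1" "\<And>b. b \<in> B \<Longrightarrow> v \<bullet> b = 0" "A *v v = \<mu> *\<^sub>R v"
      using symmetric_eigenvector_orthogonal[OF sym B(1)] B Suc.prems
      by (metis Suc_le_lessD)
    have "v \<notin> B" using v(1,2) by force
    moreover have "orthogonal v b \<and> orthogonal b v" if "b \<in> B" for b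
      using v(2)[OF that] by (simp add: orthogonal_def inner_commute)
    ultimately have "card (insert v B) = Suc k" "pairwise orthogonal (insert v B)"
      using B by (simp_all add: pairwise_insert)
    then show ?case using B(1,4) v(1,3) by (metis finite_insert insert_iff)
  qed
  from this[OF order_refl] obtain B :: "(real^'n) set"
    where B: "finite B" "card B = CARD('n)" "pairwise orthogonal B"
      "\<forall>b\<in>B. norm b = 1 \<and> (\<exists>c. A *v b = c *\<^sub>R b)" by blast
  then obtain f :: "'n \<Rightarrow> real^'n" where f: "bij_betw f UNIV B"
    using finite_same_card_bij[of "UNIV :: 'n set" B] by auto
  define Q :: "real^'n^'n" where "Q = (\<chi> i j. f j $ i)"
  have col: "column j Q = f j" for j by (simp add: column_def Q_def vec_eq_iff)
  have fB: "f i \<in> B" for i using f by (auto simp: bij_betw_def)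
  have "orthogonal (f i) (f j)" if "i \<noteq> j" for i j
  proof -
    have "f i \<noteq> f j" using f that by (auto simp: bij_betw_def inj_on_def)
    then show ?thesis using B(3) fB by (meson pairwiseD)
  qed
  moreover have "norm (f i) = 1" for i using B(4) fB by blast
  ultimately have Q: "orthogonal_matrix Q"
    by (simp add: orthogonal_matrix_orthonormal_columns col)
  have "\<forall>i. \<exists>c. A *v f i = c *\<^sub>R f i" using B(4) fB by blast
  then obtain d where "\<And>i. A *v f i = d i *\<^sub>R f i" unfolding choice_iff by blast
  then have "A *v column i Q = d i *\<^sub>R column i Q" for i by (simp only: col)
  then show ?thesis by (rule that[OF Q])
qed

definition diag_mat :: "('n \<Rightarrow> real) \<Rightarrow> real^'n^'n" where
  "diag_mat d = (\<chi> i j. if i = j then d i else 0)"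

lemma det_diag_mat: "det (diag_mat d) = (\<Prod>i\<in>UNIV. d i)"
  by (simp add: det_diagonal diag_mat_def)

lemma trace_diag_mat_mult: "trace (diag_mat d ** B) = (\<Sum>i\<in>UNIV. d i * B$i$i)"
  by (simp add: trace_def matrix_matrix_mult_def diag_mat_def if_distrib[where f="\<lambda>x. x * _"] cong: if_cong)

lemma diag_mat_mult: "diag_mat d ** diag_mat e = diag_mat (\<lambda>i. d i * e i)"
  by (simp add: vec_eq_iff matrix_matrix_mult_def diag_mat_def if_distrib[where f="\<lambda>x. x * _"] cong: if_cong)

lemma diag_mat_1: "diag_mat (\<lambda>_. 1) = mat 1"
  by (simp add: diag_mat_def mat_def)

lemma transpose_diag_mat: "transpose (diag_mat d) = diag_mat d"
  by (auto simp: diag_mat_def transpose_def vec_eq_iff)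

lemma inner_diag_mat: "x \<bullet> (diag_mat d *v x) = (\<Sum>i\<in>UNIV. d i * (x$i)\<^sup>2)"
  by (simp add: inner_vec_def matrix_vector_mult_def diag_mat_def power2_eq_square
     if_distrib[where f="\<lambda>x. x * _"] sum.delta cong: if_cong) (simp add: mult_ac)

text \<open>Symmetry is included because a real quadratic form does not see the antisymmetric part
  of its matrix, while diagonalisation by an orthogonal matrix requires that part to vanish.\<close>

definition pos_def :: "real^'n^'n \<Rightarrow> bool" where
  "pos_def A \<longleftrightarrow> transpose A = A \<and> (\<forall>x. x \<noteq> 0 \<longrightarrow> x \<bullet> (A *v x) > 0)"

lemma orthogonal_matrix_norm_column: "orthogonal_matrix Q \<Longrightarrow> norm (column i (Q::real^'n^'n)) = 1"
  by (simp add: orthogonal_matrix_orthonormal_columns)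

lemma pos_def_spectral:
  fixes A :: "real^'n^'n"
  assumes "pos_def A"
  obtains Q d where "orthogonal_matrix Q" "\<And>i. d i > 0" "A = Q ** diag_mat d ** transpose Q"
proof -
  obtain Q d where Q: "orthogonal_matrix Q" and d: "\<And>i. A *v column i Q = d i *\<^sub>R column i Q"
    using assms symmetric_eigenbasis unfolding pos_def_def by metis
  have dpos: "d i > 0" for i
  proof -
    have n: "norm (column i Q) = 1" using Q orthogonal_matrix_norm_column by blast
    then have "column i Q \<noteq> 0" by force
    then have "column i Q \<bullet> (A *v column i Q) > 0" using assms by (auto simp: pos_def_def)
    then show ?thesis using d[of i] n by (simp add: norm_eq_1)
  qed
  have "(A ** Q) $ i $ j = (Q ** diag_mat d) $ i $ j" for i j
  proof -
    have "(A *v column j Q) $ i = (d j *\<^sub>R column j Q) $ i" by (simp add: d)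
    then show ?thesis
      by (simp add: matrix_matrix_mult_def matrix_vector_mult_def column_def diag_mat_def
         if_distrib[where f="\<lambda>x. _ * x"] mult_ac cong: if_cong)
  qed
  then have "A ** Q = Q ** diag_mat d" by (simp add: vec_eq_iff)
  then have "A = Q ** diag_mat d ** transpose Q"
    using Q by (metis matrix_mul_assoc matrix_mul_rid orthogonal_matrix_def)
  then show ?thesis using that Q dpos by blast
qed

section \<open>Determinant, inverse, trace and quadratic form read off a spectral
  decomposition\<close>

context
  fixes A Q :: "real^'n^'n" and d :: "'n \<Rightarrow> real"
  assumes Q: "orthogonal_matrix Q" and d: "\<And>i. d i > 0"
    and A: "A = Q ** diag_mat d ** transpose Q"
begin

lemma spectral_det: "det A = (\<Prod>i\<in>UNIV. d i)"
proof -
  have "det Q * det (transpose Q) = 1"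
    using Q by (metis det_I det_mul orthogonal_matrix_def)
  then show ?thesis unfolding A det_mul det_diag_mat
    by (metis mult.assoc mult.commute mult.right_neutral)
qed

lemma spectral_inv: "matrix_inv A = Q ** diag_mat (\<lambda>i. 1 / d i) ** transpose Q"
proof (rule matrix_inv_unique)
  have 1: "transpose Q ** Q = mat 1" "Q ** transpose Q = mat 1"
    using Q by (auto simp: orthogonal_matrix_def)
  have d0: "d i \<noteq> 0" for i using d[of i] by simp
  have 2: "diag_mat d ** diag_mat (\<lambda>i. 1 / d i) = mat 1"
    by (simp add: diag_mat_mult d0 diag_mat_1)
  have "A ** (Q ** diag_mat (\<lambda>i. 1 / d i) ** transpose Q)
      = Q ** (diag_mat d ** ((transpose Q ** Q) ** diag_mat (\<lambda>i. 1 / d i))) ** transpose Q"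
    by (simp only: A matrix_mul_assoc)
  then show "A ** (Q ** diag_mat (\<lambda>i. 1 / d i) ** transpose Q) = mat 1"
    by (simp add: 1 2)
qed

text \<open>Only the quadratic form of \<open>B\<close> on the eigenvectors of \<open>A\<close>
  enters, so a lower bound on that form bounds the trace without symmetry or a decomposition of
  \<open>B\<close>.\<close>

lemma spectral_trace_inv:
  "trace (matrix_inv A ** B) = (\<Sum>i\<in>UNIV. (column i Q \<bullet> (B *v column i Q)) / d i)"
proof -
  have "trace (matrix_inv A ** B) = trace (Q ** (diag_mat (\<lambda>i. 1 / d i) ** (transpose Q ** B)))"
    by (simp add: spectral_inv matrix_mul_assoc)
  also have "\<dots> = trace (diag_mat (\<lambda>i. 1 / d i) ** (transpose Q ** B ** Q))"
    by (subst trace_mul_sym) (simp add: matrix_mul_assoc)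
  also have "(transpose Q ** B ** Q) $ i $ i = column i Q \<bullet> (B *v column i Q)" for i
    unfolding matrix_mul_assoc[symmetric]
    by (simp add: matrix_matrix_mult_def matrix_vector_mult_def column_def transpose_def inner_vec_def)
  ultimately show ?thesis by (simp add: trace_diag_mat_mult)
qed

lemma spectral_inner: "x \<bullet> (A *v x) = (\<Sum>i\<in>UNIV. d i * ((transpose Q *v x) $ i)\<^sup>2)"
proof -
  have "x \<bullet> (A *v x) = (transpose Q *v x) \<bullet> (diag_mat d *v (transpose Q *v x))"
    unfolding A matrix_vector_mul_assoc[symmetric] by (subst mult_matrix_vector_inner) simp
  then show ?thesis by (simp add: inner_diag_mat)
qed

lemma spectral_norm: "(\<Sum>i\<in>UNIV. ((transpose Q *v x) $ i)\<^sup>2) = x \<bullet> x"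
proof -
  have "(transpose Q *v x) \<bullet> (transpose Q *v x) = x \<bullet> x"
    using mult_matrix_vector_inner[of "transpose Q *v x" "transpose Q" x] Q
    by (metis matrix_vector_mul_assoc matrix_vector_mul_lid orthogonal_matrix_def transpose_transpose)
  then show ?thesis by (simp add: inner_vec_def power2_eq_square)
qed

end

lemma pos_def_det_pos: "pos_def A \<Longrightarrow> det A > 0"
  by (erule pos_def_spectral) (metis prod_pos spectral_det)

text \<open>A congruence \<open>R\<close> takes \<open>A\<close> to the identity and \<open>B\<close> to a matrix with eigenvalues \<open>e i\<close>; the
  difference of the two sides is then \<open>\<Sum>i. e i - 1 - ln (e i)\<close>.\<close>

lemma gaussian_cross_entropy_less:
  fixes A B :: "real^'n^'n"
  assumes A: "pos_def A" and B: "pos_def B" and "A \<noteq> B"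
  shows "ln (det B) + real CARD('n) < ln (det A) + trace (matrix_inv A ** B)"
proof -
  obtain Q d where Q: "orthogonal_matrix Q" and d: "\<And>i. d i > 0"
    and AQ: "A = Q ** diag_mat d ** transpose Q" using pos_def_spectral[OF A] by blast
  have QQ: "transpose Q ** Q = mat 1" "Q ** transpose Q = mat 1"
    using Q by (auto simp: orthogonal_matrix_def)
  \<comment> \<open>\<open>R\<close> is whitening by \<open>A\<close>:
    \<open>R ** transpose R\<close> is the inverse of \<open>A\<close>, and congruence by
    \<open>R\<close> turns \<open>A\<close> into the identity. Hence
    \<open>trace (matrix_inv A ** B)\<close> is the trace of \<open>M\<close> and
    \<open>det M = det B / det A\<close>.\<close>
  define D where "D = diag_mat (\<lambda>i. 1 / sqrt (d i))"
  define R where "R = Q ** D"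
  have d': "d i \<ge> 0" "d i \<noteq> 0" for i using d[of i] by auto
  have DD: "D ** D = diag_mat (\<lambda>i. 1 / d i)" "D ** diag_mat d ** D = mat 1" "transpose D = D"
    using d' by (simp_all add: D_def diag_mat_mult transpose_diag_mat diag_mat_1)
  have RR: "R ** transpose R = matrix_inv A"
    unfolding spectral_inv[OF Q d AQ] R_def matrix_transpose_mul DD(3)
    by (metis DD(1) matrix_mul_assoc)
  have RAR: "transpose R ** A ** R = mat 1"
  proof -
    have "transpose R ** A ** R = D ** (transpose Q ** Q) ** diag_mat d ** (transpose Q ** Q) ** D"
      unfolding R_def AQ matrix_transpose_mul DD(3) by (simp only: matrix_mul_assoc)
    then show ?thesis by (simp add: QQ DD)
  qed
  define M where "M = transpose R ** B ** R"
  have detA: "det A > 0" and detB: "det B > 0" using A B pos_def_det_pos by auto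
  have detR: "det R * det R * det A = 1"
    using arg_cong[OF RAR, of det] by (simp add: det_mul mult_ac)
  then have detR0: "det R \<noteq> 0" by auto
  have inj: "R *v x \<noteq> 0" if "x \<noteq> 0" for x
    using detR0 that by (metis invertible_det_nz invertible_left_inverse matrix_left_invertible_ker)
  have "pos_def M"
    unfolding pos_def_def
  proof safe
    show "transpose M = M"
      using B by (simp add: M_def matrix_transpose_mul matrix_mul_assoc pos_def_def)
    fix x :: "real^'n" assume "x \<noteq> 0"
    have "x \<bullet> (M *v x) = (R *v x) \<bullet> (B *v (R *v x))"
      unfolding M_def matrix_vector_mul_assoc[symmetric] by (subst mult_matrix_vector_inner) simp
    then show "x \<bullet> (M *v x) > 0" using B inj[OF \<open>x \<noteq> 0\<close>] by (simp add: pos_def_def)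
  qed
  then obtain P e where P: "orthogonal_matrix P" and e: "\<And>i. e i > 0"
    and MP: "M = P ** diag_mat e ** transpose P" using pos_def_spectral by blast
  have PP: "transpose P ** P = mat 1" "P ** transpose P = mat 1"
    using P by (auto simp: orthogonal_matrix_def)
  \<comment> \<open>Strictness: if all eigenvalues of \<open>M\<close> were 1, then \<open>A\<close>
    and \<open>B\<close> would have the same image under congruence by the invertible
    \<open>R\<close>, hence be equal. A single \<open>e i\<close> different from 1 makes
    \<open>ln (e i) \<le> e i - 1\<close> strict.\<close>
  have e1: "\<exists>i. e i \<noteq> 1"
  proof (rule ccontr)
    assume "\<not> ?thesis"
    then have "e = (\<lambda>_. 1)" by auto
    then have "M = mat 1" using MP PP by (simp add: diag_mat_1)
    then have eq: "transpose R ** A ** R = transpose R ** B ** R" using RAR M_def by simp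
    obtain S where S: "R ** S = mat 1" "S ** R = mat 1"
      using detR0 by (metis invertible_det_nz invertible_def)
    have "transpose S ** (transpose R ** A ** R) ** S = transpose (R ** S) ** A ** (R ** S)"
      by (simp only: matrix_transpose_mul matrix_mul_assoc)
    moreover have "transpose S ** (transpose R ** B ** R) ** S = transpose (R ** S) ** B ** (R ** S)"
      by (simp only: matrix_transpose_mul matrix_mul_assoc)
    ultimately show False using eq S \<open>A \<noteq> B\<close> by (simp add: transpose_mat)
  qed
  have "trace (matrix_inv A ** B) = trace M"
    unfolding RR[symmetric] M_def
    by (metis matrix_mul_assoc trace_mul_sym)
  also have "\<dots> = trace (diag_mat e ** mat 1)"
    unfolding MP by (subst trace_mul_sym) (metis PP(1) matrix_mul_assoc matrix_mul_lid matrix_mul_rid trace_mul_sym)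
  also have "\<dots> = (\<Sum>i\<in>UNIV. e i)" unfolding trace_diag_mat_mult by (simp add: mat_def)
  finally have tr: "trace (matrix_inv A ** B) = (\<Sum>i\<in>UNIV. e i)" .
  have "det M = det B / det A"
    using detR detA by (simp add: M_def det_mul field_simps)
  then have "ln (det B) - ln (det A) = ln (det M)"
    using detA detB by (simp add: ln_div)
  also have "\<dots> = (\<Sum>i\<in>UNIV. ln (e i))"
    unfolding spectral_det[OF P e MP] by (rule ln_prod) (use e in \<open>auto simp: less_imp_neq[symmetric]\<close>)
  also have "\<dots> < (\<Sum>i\<in>UNIV. e i - 1)"
  proof (rule sum_strict_mono_ex1)
    show "\<forall>i\<in>UNIV. ln (e i) \<le> e i - 1" using e ln_le_minus_one by blast
    obtain i where "e i \<noteq> 1" using e1 by blast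
    then have "ln (e i) < e i - 1"
      using e[of i] ln_le_minus_one[of "e i"] ln_eq_minus_one[of "e i"] by force
    then show "\<exists>i\<in>UNIV. ln (e i) < e i - 1" by blast
  qed simp
  also have "\<dots> = (\<Sum>i\<in>UNIV. e i) - real CARD('n)" by (simp add: sum_subtractf)
  finally show ?thesis using tr by simp
qed

section \<open>Coercivity of the cross entropy, uniformly in the second-moment matrix\<close>

lemma ln_plus_divide_lower:
  fixes c l :: real
  assumes "c > 0" "l > 0"
  shows "1 + ln c \<le> ln l + c / l"
  using ln_le_minus_one[of "c / l"] assms by (simp add: ln_div)

text \<open>Each eigenvalue \<open>d\<close> of \<open>A\<close> contributes at least
  \<open>ln d + c / d\<close>, which is large both for large and for small \<open>d\<close> and
  never falls below \<open>1 + ln c\<close>. A bound on the total therefore bounds every single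
  term, and so every eigenvalue on both sides. The bounds \<open>l\<close> and \<open>u\<close> are
  fixed before \<open>A\<close> and \<open>B\<close>; that is the uniformity required later.\<close>

lemma gaussian_cross_entropy_coercive:
  fixes c T :: real
  assumes c: "c > 0"
  obtains l u :: real where "0 < l"
    "\<And>A B x. pos_def (A::real^'n^'n) \<Longrightarrow> (\<And>y. c * (y \<bullet> y) \<le> y \<bullet> (B *v y)) \<Longrightarrow>
      ln (det A) + trace (matrix_inv A ** B) \<le> T \<Longrightarrow>
      l * (x \<bullet> x) \<le> x \<bullet> (A *v x) \<and> x \<bullet> (A *v x) \<le> u * (x \<bullet> x)"
proof -
  \<comment> \<open>The budget of one eigenvalue: \<open>T\<close> minus the least possible
    contribution of the other \<open>CARD('n) - 1\<close>.\<close>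
  define T' where "T' = T - (real CARD('n) - 1) * (1 + ln c)"
  \<comment> \<open>An upper bound for \<open>c / (2 * d i)\<close>; the maximum with 1 keeps it
    positive, so that \<open>l\<close> is well defined and positive.\<close>
  define b where "b = max 1 (T' - (1 + ln (c / 2)))"
  define l where "l = c / (2 * b)"
  define u where "u = exp T'"
  have "b > 0" by (simp add: b_def)
  then have l: "l > 0" using c by (simp add: l_def)
  have "l * (x \<bullet> x) \<le> x \<bullet> (A *v x) \<and> x \<bullet> (A *v x) \<le> u * (x \<bullet> x)"
    if A: "pos_def A" and B: "\<And>y. c * (y \<bullet> y) \<le> y \<bullet> (B *v y)"
      and T: "ln (det A) + trace (matrix_inv A ** B) \<le> T" for A B :: "real^'n^'n" and x
  proof -
    obtain Q d where Q: "orthogonal_matrix Q" and d: "\<And>i. d i > 0"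
      and AQ: "A = Q ** diag_mat d ** transpose Q" using pos_def_spectral[OF A] by blast
    have "(\<Sum>i\<in>UNIV. ln (d i) + c / d i) \<le> T"
    proof -
      have "c \<le> column i Q \<bullet> (B *v column i Q)" for i
        using B[of "column i Q"] orthogonal_matrix_norm_column[OF Q, of i] by (simp add: norm_eq_1)
      then have "(\<Sum>i\<in>UNIV. c / d i) \<le> trace (matrix_inv A ** B)"
        unfolding spectral_trace_inv[OF Q d AQ]
        by (intro sum_mono divide_right_mono) (auto simp: d less_imp_le)
      moreover have "ln (det A) = (\<Sum>i\<in>UNIV. ln (d i))"
        unfolding spectral_det[OF Q d AQ] by (rule ln_prod) (use d in \<open>auto simp: less_imp_neq[symmetric]\<close>)
      ultimately show ?thesis using T by (simp add: sum.distrib)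
    qed
    then have single: "ln (d i) + c / d i \<le> T'" for i
    proof -
      have "(\<Sum>j\<in>UNIV. ln (d j) + c / d j) = (ln (d i) + c / d i) + (\<Sum>j\<in>UNIV - {i}. ln (d j) + c / d j)"
        by (simp add: sum.remove)
      moreover have "(\<Sum>j\<in>UNIV - {i}. 1 + ln c) \<le> (\<Sum>j\<in>UNIV - {i}. ln (d j) + c / d j)"
        by (intro sum_mono ln_plus_divide_lower c d)
      moreover have "(\<Sum>j\<in>UNIV - {i}. 1 + ln c) = (real CARD('n) - 1) * (1 + ln c)"
        by (simp add: card_Diff_singleton of_nat_diff Suc_le_eq)
      ultimately show ?thesis using \<open>(\<Sum>i\<in>UNIV. ln (d i) + c / d i) \<le> T\<close> unfolding T'_def by linarith
    qed
    have upper: "d i \<le> u" for i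
    proof -
      have "c / d i > 0" using c d by simp
      then have "ln (d i) \<le> T'" using single[of i] by linarith
      then show ?thesis using d[of i] unfolding u_def by (metis exp_le_cancel_iff exp_ln)
    qed
    have lower: "l \<le> d i" for i
    proof -
      \<comment> \<open>Half of \<open>c / d i\<close> absorbs the possibly very negative
        \<open>ln (d i)\<close>; the other half is then bounded by what is left of the
        budget.\<close>
      have "1 + ln (c / 2) \<le> ln (d i) + c / 2 / d i" by (rule ln_plus_divide_lower) (use c d in auto)
      moreover have "c / d i = c / 2 / d i + c / 2 / d i" by simp
      ultimately have "c / 2 / d i \<le> b" using single[of i] unfolding b_def by linarith
      then show ?thesis using d[of i] \<open>b > 0\<close> by (simp add: l_def field_simps)
    qed
    have "(\<Sum>i\<in>UNIV. l * ((transpose Q *v x) $ i)\<^sup>2) \<le> (\<Sum>i\<in>UNIV. d i * ((transpose Q *v x) $ i)\<^sup>2)"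
      by (intro sum_mono mult_right_mono lower) auto
    moreover have "(\<Sum>i\<in>UNIV. d i * ((transpose Q *v x) $ i)\<^sup>2) \<le> (\<Sum>i\<in>UNIV. u * ((transpose Q *v x) $ i)\<^sup>2)"
      by (intro sum_mono mult_right_mono upper) auto
    ultimately show ?thesis
      by (simp only: spectral_inner[OF Q d AQ] sum_distrib_left[symmetric] spectral_norm[OF Q d AQ])
  qed
  with l that show ?thesis by blast
qed

section \<open>Minimisers of the cross entropy over the model\<close>

lemma continuous_on_det:
  fixes f :: "'a::topological_space \<Rightarrow> real^'n^'n"
  assumes "continuous_on T f"
  shows "continuous_on T (\<lambda>x. det (f x))"
  unfolding det_def by (intro continuous_intros assms)

text \<open>Cramer's rule for the columns of the inverse. It exhibits the entries as quotients of
  determinants, from which continuity of inversion follows.\<close>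

lemma matrix_inv_nth:
  fixes A :: "real^'n^'n"
  assumes "det A \<noteq> 0"
  shows "matrix_inv A $ i $ j = det (\<chi> k l. if l = i then axis j 1 $ k else A $ k $ l) / det A"
proof -
  have "A *v (matrix_inv A *v axis j 1) = axis j 1"
    by (simp add: matrix_vector_mul_assoc matrix_inv_mult_right assms)
  then have "matrix_inv A *v axis j 1
      = (\<chi> i. det (\<chi> k l. if l = i then axis j 1 $ k else A $ k $ l) / det A)"
    using cramer[OF assms] by blast
  moreover have "(matrix_inv A *v axis j 1) $ i = matrix_inv A $ i $ j"
    by (simp add: matrix_vector_mult_basis column_def)
  ultimately show ?thesis by simp
qed

lemma continuous_on_matrix_inv:
  fixes f :: "'a::topological_space \<Rightarrow> real^'n^'n"
  assumes f: "continuous_on T f" and nz: "\<And>x. x \<in> T \<Longrightarrow> det (f x) \<noteq> 0"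
  shows "continuous_on T (\<lambda>x. matrix_inv (f x))"
proof -
  have "continuous_on T (\<lambda>x. if l = i then axis j 1 $ k else f x $ k $ l :: real)" for i j k l
    by (cases "l = i") (auto intro!: continuous_intros f)
  then have "continuous_on T (\<lambda>x. \<chi> i j. det (\<chi> k l. if l = i then axis j 1 $ k else f x $ k $ l) / det (f x))"
    by (intro continuous_on_vec_lambda continuous_on_divide continuous_on_det f) (auto simp: nz)
  then show ?thesis
    by (rule continuous_on_eq) (simp add: vec_eq_iff matrix_inv_nth nz)
qed

section \<open>The loss, the model covariance and compact sublevel sets\<close>

definition ppca_loss :: "real^'p^'p \<Rightarrow> (real^'q^'p) \<times> real \<Rightarrow> real" where
  "ppca_loss S \<theta> = ln (det (ppca_cov \<theta>)) + trace (matrix_inv (ppca_cov \<theta>) ** S)"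

text \<open>Second moments about 0 without centring, since the model has mean 0; observations are
  numbered from 1.\<close>

definition sample_cov :: "(nat \<Rightarrow> real^'p) \<Rightarrow> nat \<Rightarrow> real^'p^'p" where
  "sample_cov x n = (\<chi> a b. (\<Sum>i=1..n. x i $ a * x i $ b) / real n)"

text \<open>Used with three kinds of vectors: arbitrary ones for positive definiteness, kernel
  vectors of the transposed loading matrix to isolate the noise variance, and coordinate vectors to
  reach the row norms.\<close>

lemma ppca_cov_inner:
  fixes \<theta> :: "(real^'q^'p) \<times> real"
  shows "x \<bullet> (ppca_cov \<theta> *v x) = (norm (transpose (fst \<theta>) *v x))\<^sup>2 + snd \<theta> * (x \<bullet> x)"
proof -
  have "ppca_cov \<theta> *v x = fst \<theta> *v (transpose (fst \<theta>) *v x) + snd \<theta> *\<^sub>R x"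
    by (simp add: ppca_cov_def matrix_vector_mult_add_rdistrib matrix_vector_mul_assoc
        scaleR_matrix_vector_assoc[symmetric] del: transpose_matrix_vector)
  then show ?thesis
    using mult_matrix_vector_inner[of x "fst \<theta>" "transpose (fst \<theta>) *v x"]
    by (simp add: inner_add_right power2_norm_eq_inner)
qed

lemma transpose_ppca_cov: "transpose (ppca_cov \<theta>) = ppca_cov \<theta>"
  by (auto simp: ppca_cov_def vec_eq_iff transpose_def matrix_matrix_mult_def mat_def mult.commute)

lemma ppca_cov_pos_def:
  fixes \<theta> :: "(real^'q^'p) \<times> real"
  assumes "\<theta> \<in> ppca_params"
  shows "pos_def (ppca_cov \<theta>)"
  unfolding pos_def_def
proof safe
  show "transpose (ppca_cov \<theta>) = ppca_cov \<theta>" by (rule transpose_ppca_cov)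
  fix x :: "real^'p" assume "x \<noteq> 0"
  then have "0 < snd \<theta> * (x \<bullet> x)" using assms by (auto simp: ppca_params_def)
  then show "0 < x \<bullet> (ppca_cov \<theta> *v x)" unfolding ppca_cov_inner
    by (simp add: add_nonneg_pos)
qed

lemma continuous_on_ppca_cov: "continuous_on T (ppca_cov :: (real^'q^'p) \<times> real \<Rightarrow> _)"
proof -
  have eq: "ppca_cov = (\<lambda>\<theta>::(real^'q^'p) \<times> real.
      \<chi> i j. (\<Sum>k\<in>UNIV. fst \<theta> $ i $ k * fst \<theta> $ j $ k) + snd \<theta> * (if i = j then 1 else 0))"
    by (auto simp: fun_eq_iff ppca_cov_def vec_eq_iff matrix_matrix_mult_def transpose_def mat_def)
  show ?thesis by (subst eq) (intro continuous_intros)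
qed

lemma continuous_on_ppca_precision:
  "continuous_on ppca_params (\<lambda>\<theta>::(real^'q^'p) \<times> real. matrix_inv (ppca_cov \<theta>))"
proof (intro continuous_on_matrix_inv continuous_on_ppca_cov)
  show "det (ppca_cov \<theta>) \<noteq> 0" if "\<theta> \<in> ppca_params" for \<theta> :: "(real^'q^'p) \<times> real"
    using pos_def_det_pos[OF ppca_cov_pos_def[OF that]] by simp
qed

lemma continuous_on_ppca_loss:
  "continuous_on ppca_params (ppca_loss S :: (real^'q^'p) \<times> real \<Rightarrow> _)"
proof -
  have "det (ppca_cov \<theta>) \<noteq> 0" if "\<theta> \<in> ppca_params" for \<theta> :: "(real^'q^'p) \<times> real"
    using pos_def_det_pos[OF ppca_cov_pos_def[OF that]] by simp
  then show ?thesis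
    unfolding ppca_loss_def[abs_def] trace_def matrix_matrix_mult_def
    by (auto intro!: continuous_intros continuous_on_det continuous_on_ppca_cov continuous_on_ppca_precision)
qed

text \<open>Meant for \<open>transpose (fst \<theta>)\<close>, which has \<open>q\<close> rows and
  \<open>p\<close> columns; this is the point where \<open>q < p\<close> enters.\<close>

lemma wide_matrix_kernel:
  fixes A :: "real^'n^'m"
  assumes "CARD('m) < CARD('n)"
  obtains x where "x \<noteq> 0" "A *v x = 0"
  using assms rank_bound[of A] matrix_nonfull_linear_equations_eq[of A] by auto

text \<open>The noise variance is an eigenvalue of the covariance matrix because \<open>q < p\<close>; hence it is
  bounded below on a sublevel set, and the diagonal of the covariance matrix bounds \<open>W\<close>.\<close>

lemma ppca_loss_sublevel_compact:
  assumes card: "CARD('q) < CARD('p)" and c: "c > 0"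
  obtains K :: "((real^'q^'p) \<times> real) set" where "compact K" "K \<subseteq> ppca_params"
    "\<And>S \<theta>. \<theta> \<in> ppca_params \<Longrightarrow> (\<And>y. c * (y \<bullet> y) \<le> y \<bullet> (S *v y)) \<Longrightarrow> ppca_loss S \<theta> \<le> T \<Longrightarrow> \<theta> \<in> K"
proof -
  obtain l u where l: "0 < l"
    and lu: "\<And>A B x. pos_def (A::real^'p^'p) \<Longrightarrow> (\<And>y. c * (y \<bullet> y) \<le> y \<bullet> (B *v y)) \<Longrightarrow>
      ln (det A) + trace (matrix_inv A ** B) \<le> T \<Longrightarrow>
      l * (x \<bullet> x) \<le> x \<bullet> (A *v x) \<and> x \<bullet> (A *v x) \<le> u * (x \<bullet> x)"
    using gaussian_cross_entropy_coercive[OF c, where ?'n = 'p] by metis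
  \<comment> \<open>The radius sums \<open>p\<close> row norms, each at most \<open>sqrt u\<close>.
    The lower end \<open>l > 0\<close> keeps \<open>K\<close> away from the missing boundary of the
    parameter space at noise variance 0.\<close>
  define K :: "((real^'q^'p) \<times> real) set" where
    "K = cball 0 (real CARD('p) * sqrt u) \<times> {l..u}"
  have "\<theta> \<in> K" if \<theta>: "\<theta> \<in> ppca_params" and S: "\<And>y. c * (y \<bullet> y) \<le> y \<bullet> (S *v y)"
    and T: "ppca_loss S \<theta> \<le> T" for S and \<theta> :: "(real^'q^'p) \<times> real"
  proof -
    have spos: "snd \<theta> > 0" using \<theta> by (auto simp: ppca_params_def)
    have bounds: "l * (x \<bullet> x) \<le> x \<bullet> (ppca_cov \<theta> *v x)" "x \<bullet> (ppca_cov \<theta> *v x) \<le> u * (x \<bullet> x)" for x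
      using lu[OF ppca_cov_pos_def[OF \<theta>] S T[unfolded ppca_loss_def]] by auto
    obtain x where x: "x \<noteq> 0" "transpose (fst \<theta>) *v x = 0"
      using wide_matrix_kernel[OF card] by blast
    then have "x \<bullet> (ppca_cov \<theta> *v x) = snd \<theta> * (x \<bullet> x)" unfolding ppca_cov_inner x(2) by simp
    then have s: "l \<le> snd \<theta>" "snd \<theta> \<le> u" using bounds[of x] x(1) by auto
    have row: "norm (fst \<theta> $ i) \<le> sqrt u" for i
    proof -
      have "(norm (fst \<theta> $ i))\<^sup>2 + snd \<theta> \<le> u"
        using bounds(2)[of "axis i 1"] unfolding ppca_cov_inner
        by (simp add: matrix_vector_mult_basis column_transpose row_def inner_axis_axis vec_nth_inverse)
      then show ?thesis using spos by (intro real_le_rsqrt) linarith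
    qed
    have "norm (fst \<theta>) \<le> (\<Sum>i\<in>UNIV. norm (fst \<theta> $ i))"
      unfolding norm_vec_def[of "fst \<theta>"] by (rule L2_set_le_sum) auto
    also have "\<dots> \<le> real CARD('p) * sqrt u"
      using sum_bounded_above[of UNIV "\<lambda>i. norm (fst \<theta> $ i)" "sqrt u"] row by simp
    finally show ?thesis using s by (cases \<theta>) (simp add: K_def)
  qed
  moreover have "compact K" unfolding K_def by (intro compact_Times) auto
  moreover have "K \<subseteq> ppca_params" using l by (auto simp: K_def ppca_params_def)
  ultimately show ?thesis using that by blast
qed

section \<open>Stability of minimisers under perturbation of the second-moment matrix\<close>

lemma trace_mult_diff_le:
  fixes A S S' :: "real^'n^'n"
  assumes "\<And>i j. \<bar>S $ i $ j - S' $ i $ j\<bar> \<le> \<delta>"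
  shows "\<bar>trace (A ** S) - trace (A ** S')\<bar> \<le> (\<Sum>i\<in>UNIV. \<Sum>j\<in>UNIV. \<bar>A $ i $ j\<bar>) * \<delta>"
proof -
  have "trace (A ** S) - trace (A ** S') = (\<Sum>i\<in>UNIV. \<Sum>j\<in>UNIV. A $ i $ j * (S $ j $ i - S' $ j $ i))"
    by (simp add: trace_def matrix_matrix_mult_def sum_subtractf algebra_simps)
  also have "\<bar>\<dots>\<bar> \<le> (\<Sum>i\<in>UNIV. \<Sum>j\<in>UNIV. \<bar>A $ i $ j\<bar> * \<delta>)"
    by (intro order_trans[OF sum_abs] sum_mono) (auto simp: abs_mult intro!: mult_left_mono assms)
  finally show ?thesis by (simp add: sum_distrib_right)
qed

text \<open>Transfers a lower bound on the quadratic form of the true covariance to every nearby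
  matrix, as the uniform compactness demands. The factor counts the entries, each weighted by a
  product \<open>y $ i * y $ j\<close> of size at most \<open>y \<bullet> y\<close>.\<close>

lemma quadratic_form_diff_le:
  fixes S S' :: "real^'n^'n"
  assumes "\<And>i j. \<bar>S $ i $ j - S' $ i $ j\<bar> \<le> \<delta>"
  shows "\<bar>y \<bullet> (S *v y) - y \<bullet> (S' *v y)\<bar> \<le> (real CARD('n))\<^sup>2 * \<delta> * (y \<bullet> y)"
proof -
  have comp: "\<bar>y $ i\<bar> * \<bar>y $ j\<bar> \<le> y \<bullet> y" for i j
    using mult_mono[OF component_le_norm_cart[of y i] component_le_norm_cart[of y j]]
    by (simp add: power2_norm_eq_inner[symmetric] power2_eq_square)
  \<comment> \<open>The bound at any one entry shows this; \<open>undefined\<close> serves as an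
    index.\<close>
  have d: "\<delta> \<ge> 0" using assms[of undefined undefined] by linarith
  have "y \<bullet> (S *v y) - y \<bullet> (S' *v y) = (\<Sum>i\<in>UNIV. \<Sum>j\<in>UNIV. (S $ i $ j - S' $ i $ j) * (y $ i * y $ j))"
    by (simp add: inner_vec_def matrix_vector_mult_def sum_distrib_left sum_subtractf algebra_simps)
  also have "\<bar>\<dots>\<bar> \<le> (\<Sum>i\<in>(UNIV::'n set). \<Sum>j\<in>(UNIV::'n set). \<delta> * (y \<bullet> y))"
  proof (intro order_trans[OF sum_abs] sum_mono)
    fix i j
    show "\<bar>(S $ i $ j - S' $ i $ j) * (y $ i * y $ j)\<bar> \<le> \<delta> * (y \<bullet> y)"
      unfolding abs_mult by (intro mult_mono assms comp d) auto
  qed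
  finally show ?thesis by (simp add: power2_eq_square mult_ac)
qed

text \<open>At \<open>\<theta>\<^sub>0\<close> the trace term is the dimension, so this is the
  strict cross entropy inequality between two distinct covariances.\<close>

lemma ppca_loss_less_off_fiber:
  fixes \<theta> \<theta>\<^sub>0 :: "(real^'q^'p) \<times> real"
  assumes "\<theta> \<in> ppca_params" "\<theta>\<^sub>0 \<in> ppca_params" "\<theta> \<notin> ppca_fiber \<theta>\<^sub>0"
  shows "ppca_loss (ppca_cov \<theta>\<^sub>0) \<theta>\<^sub>0 < ppca_loss (ppca_cov \<theta>\<^sub>0) \<theta>"
proof -
  have "det (ppca_cov \<theta>\<^sub>0) \<noteq> 0" using pos_def_det_pos[OF ppca_cov_pos_def[OF assms(2)]] by simp
  then have "matrix_inv (ppca_cov \<theta>\<^sub>0) ** ppca_cov \<theta>\<^sub>0 = mat 1"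
    using matrix_inv_mult_right matrix_left_right_inverse by blast
  then have "ppca_loss (ppca_cov \<theta>\<^sub>0) \<theta>\<^sub>0 = ln (det (ppca_cov \<theta>\<^sub>0)) + real CARD('p)"
    by (simp add: ppca_loss_def trace_I)
  moreover have "ppca_cov \<theta> \<noteq> ppca_cov \<theta>\<^sub>0" using assms by (auto simp: ppca_fiber_def)
  ultimately show ?thesis
    using gaussian_cross_entropy_less[OF ppca_cov_pos_def ppca_cov_pos_def] assms
    by (simp add: ppca_loss_def)
qed

text \<open>Away from the fibre the limiting loss exceeds its minimum by a gap \<open>\<eta>\<close>
  on a compact set; the loss is Lipschitz in \<open>S\<close>, uniformly on that set, so a small
  change of \<open>S\<close> cannot close the gap. The last conclusion asks only that
  \<open>\<theta>\<close> do no worse than \<open>\<theta>\<^sub>0\<close>, a single comparison that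
  every maximum likelihood estimate passes.\<close>

lemma ppca_loss_minimizer_near:
  fixes \<theta>\<^sub>0 :: "(real^'q^'p) \<times> real"
  assumes card: "CARD('q) < CARD('p)" and \<theta>\<^sub>0: "\<theta>\<^sub>0 \<in> ppca_params" and \<epsilon>: "\<epsilon> > 0"
  obtains \<delta> where "\<delta> > 0"
    "\<And>S. (\<And>i j. \<bar>S $ i $ j - ppca_cov \<theta>\<^sub>0 $ i $ j\<bar> < \<delta>) \<Longrightarrow>
        \<exists>\<theta>::(real^'q^'p) \<times> real. \<theta> \<in> ppca_params \<and> (\<forall>\<phi>\<in>ppca_params. ppca_loss S \<theta> \<le> ppca_loss S (\<phi> :: (real^'q^'p) \<times> real))"
    "\<And>S \<theta>. (\<And>i j. \<bar>S $ i $ j - ppca_cov \<theta>\<^sub>0 $ i $ j\<bar> < \<delta>) \<Longrightarrow> \<theta> \<in> ppca_params \<Longrightarrow>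
        ppca_loss S \<theta> \<le> ppca_loss S \<theta>\<^sub>0 \<Longrightarrow> infdist \<theta> (ppca_fiber \<theta>\<^sub>0) < \<epsilon>"
proof -
  define S\<^sub>0 where "S\<^sub>0 = ppca_cov \<theta>\<^sub>0"
  \<comment> \<open>Half the noise variance: the quadratic form of \<open>S\<^sub>0\<close> is at
    least \<open>2 * c\<close> times the squared norm, which leaves a margin \<open>c\<close> for
    the perturbation.\<close>
  define c where "c = snd \<theta>\<^sub>0 / 2"
  \<comment> \<open>A Lipschitz constant of the loss in \<open>S\<close> at fixed
    \<open>\<theta>\<close>, with respect to the largest entry of the perturbation: only the trace
    term depends on \<open>S\<close>, and linearly.\<close>
  define g where "g = (\<lambda>\<theta>::(real^'q^'p) \<times> real. \<Sum>i\<in>UNIV. \<Sum>j\<in>UNIV. \<bar>matrix_inv (ppca_cov \<theta>) $ i $ j\<bar>)"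
  have c: "c > 0" using \<theta>\<^sub>0 by (auto simp: c_def ppca_params_def)
  have S0: "2 * c * (y \<bullet> y) \<le> y \<bullet> (S\<^sub>0 *v y)" for y by (simp add: S\<^sub>0_def ppca_cov_inner c_def)
  \<comment> \<open>The slack 1 in the level makes \<open>K\<close> contain every parameter that
    does at least as well as \<open>\<theta>\<^sub>0\<close> under a perturbed \<open>S\<close>,
    since the loss of \<open>\<theta>\<^sub>0\<close> itself rises by at most 1/3.\<close>
  obtain K :: "((real^'q^'p) \<times> real) set" where K: "compact K" "K \<subseteq> ppca_params"
    and sublevel: "\<And>S \<theta>. \<theta> \<in> ppca_params \<Longrightarrow> (\<And>y. c * (y \<bullet> y) \<le> y \<bullet> (S *v y)) \<Longrightarrow>
       ppca_loss S \<theta> \<le> ppca_loss S\<^sub>0 \<theta>\<^sub>0 + 1 \<Longrightarrow> \<theta> \<in> K"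
    using ppca_loss_sublevel_compact[OF card c] by metis
  have "c * (y \<bullet> y) \<le> y \<bullet> (S\<^sub>0 *v y)" for y
  proof -
    have "0 \<le> c * (y \<bullet> y)" using c by simp
    then show ?thesis using S0[of y] by linarith
  qed
  then have \<theta>\<^sub>0K: "\<theta>\<^sub>0 \<in> K" using sublevel[OF \<theta>\<^sub>0, of S\<^sub>0] by simp
  have "continuous_on K g"
    unfolding g_def
    by (intro continuous_intros continuous_on_subset[OF continuous_on_ppca_precision K(2)])
  then obtain b where b: "\<And>\<theta>. \<theta> \<in> K \<Longrightarrow> g \<theta> \<le> b"
    using continuous_attains_sup[OF K(1), of g] \<theta>\<^sub>0K by blast
  have "g \<theta>\<^sub>0 \<ge> 0" unfolding g_def by (intro sum_nonneg) auto
  then have b0: "b \<ge> 0" using b[OF \<theta>\<^sub>0K] by simp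
  have loss_cont: "continuous_on K (ppca_loss S)" for S
    by (rule continuous_on_subset[OF continuous_on_ppca_loss K(2)])
  \<comment> \<open>The part of \<open>K\<close> at distance at least \<open>\<epsilon>\<close> from
    the fibre. It is compact, so strict inequality there improves to a uniform gap; if it is empty,
    any gap will do.\<close>
  define K' where "K' = K \<inter> {\<theta>. \<epsilon> \<le> infdist \<theta> (ppca_fiber \<theta>\<^sub>0)}"
  have "closed {\<theta>. \<epsilon> \<le> infdist \<theta> (ppca_fiber \<theta>\<^sub>0)}"
    by (intro closed_Collect_le continuous_intros)
  then have K': "compact K'" using K(1) unfolding K'_def by (rule compact_Int_closed[rotated])
  have strict: "ppca_loss S\<^sub>0 \<theta>\<^sub>0 < ppca_loss S\<^sub>0 \<theta>" if "\<theta> \<in> K'" for \<theta>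
  proof -
    have "\<theta> \<notin> ppca_fiber \<theta>\<^sub>0" using that \<epsilon> infdist_zero[of \<theta> "ppca_fiber \<theta>\<^sub>0"] by (auto simp: K'_def)
    then show ?thesis using that K(2) \<theta>\<^sub>0 unfolding S\<^sub>0_def K'_def by (intro ppca_loss_less_off_fiber) auto
  qed
  obtain \<eta> where \<eta>: "\<eta> > 0" "\<And>\<theta>. \<theta> \<in> K' \<Longrightarrow> ppca_loss S\<^sub>0 \<theta>\<^sub>0 + \<eta> \<le> ppca_loss S\<^sub>0 \<theta>"
  proof (cases "K' = {}")
    case True
    then show ?thesis using that[of 1] by simp
  next
    case False
    have "continuous_on K' (ppca_loss S\<^sub>0)"
      using loss_cont continuous_on_subset by (metis K'_def inf_le1)
    then obtain \<theta>\<^sub>1 where "\<theta>\<^sub>1 \<in> K'" "\<And>\<theta>. \<theta> \<in> K' \<Longrightarrow> ppca_loss S\<^sub>0 \<theta>\<^sub>1 \<le> ppca_loss S\<^sub>0 \<theta>"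
      using continuous_attains_inf[OF K' False] by metis
    then show ?thesis using that[of "ppca_loss S\<^sub>0 \<theta>\<^sub>1 - ppca_loss S\<^sub>0 \<theta>\<^sub>0"] strict by simp
  qed
  \<comment> \<open>The first bound costs the quadratic form at most \<open>c\<close>. The second
    keeps the change of the loss on \<open>K\<close> below \<open>min 1 \<eta> / 3\<close>: two such
    changes, at \<open>\<theta>\<close> and at \<open>\<theta>\<^sub>0\<close>, stay below the gap
    \<open>\<eta>\<close>, and one stays below the slack 1. The denominator uses
    \<open>b + 1\<close> because \<open>b\<close> is only known to be nonnegative.\<close>
  define \<delta> where "\<delta> = min (c / (real CARD('p))\<^sup>2) (min 1 \<eta> / (3 * (b + 1)))"
  have \<delta>: "\<delta> > 0" using c b0 \<eta>(1) by (simp add: \<delta>_def)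
  have "b * \<delta> \<le> b * (min 1 \<eta> / (3 * (b + 1)))" using b0 by (intro mult_left_mono) (simp_all add: \<delta>_def)
  also have "\<dots> \<le> (b + 1) * (min 1 \<eta> / (3 * (b + 1)))"
    using b0 \<eta>(1) by (intro mult_right_mono) auto
  also have "\<dots> = min 1 \<eta> / 3"
  proof -
    have "(b + 1) * (m / (3 * (b + 1))) = m / 3" for m
      using b0 by (simp add: field_simps)
    then show ?thesis .
  qed
  finally have b\<delta>: "b * \<delta> \<le> min 1 \<eta> / 3" .
  have p\<delta>: "(real CARD('p))\<^sup>2 * \<delta> \<le> c"
  proof -
    have "(real CARD('p))\<^sup>2 * \<delta> \<le> (real CARD('p))\<^sup>2 * (c / (real CARD('p))\<^sup>2)"
      by (intro mult_left_mono) (simp_all add: \<delta>_def)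
    then show ?thesis by simp
  qed
  have perturb: "\<bar>ppca_loss S \<theta> - ppca_loss S\<^sub>0 \<theta>\<bar> \<le> min 1 \<eta> / 3"
    if S: "\<And>i j. \<bar>S $ i $ j - S\<^sub>0 $ i $ j\<bar> < \<delta>" and \<theta>: "\<theta> \<in> K" for S and \<theta> :: "(real^'q^'p) \<times> real"
  proof -
    have "\<bar>ppca_loss S \<theta> - ppca_loss S\<^sub>0 \<theta>\<bar> \<le> g \<theta> * \<delta>"
      unfolding g_def ppca_loss_def using trace_mult_diff_le[of S S\<^sub>0 \<delta>] S by (simp add: less_imp_le)
    also have "\<dots> \<le> b * \<delta>" using b[OF \<theta>] \<delta> by simp
    finally show ?thesis using b\<delta> by simp
  qed
  have inK: "\<theta> \<in> K"
    if S: "\<And>i j. \<bar>S $ i $ j - S\<^sub>0 $ i $ j\<bar> < \<delta>" and \<theta>: "\<theta> \<in> ppca_params"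
      and le: "ppca_loss S \<theta> \<le> ppca_loss S \<theta>\<^sub>0" for S and \<theta> :: "(real^'q^'p) \<times> real"
  proof (rule sublevel[OF \<theta>])
    show "ppca_loss S \<theta> \<le> ppca_loss S\<^sub>0 \<theta>\<^sub>0 + 1" using perturb[OF S \<theta>\<^sub>0K] le by linarith
    fix y
    have "\<bar>y \<bullet> (S *v y) - y \<bullet> (S\<^sub>0 *v y)\<bar> \<le> (real CARD('p))\<^sup>2 * \<delta> * (y \<bullet> y)"
      by (rule quadratic_form_diff_le) (use S in \<open>simp add: less_imp_le\<close>)
    also have "\<dots> \<le> c * (y \<bullet> y)" using p\<delta> by (intro mult_right_mono) auto
    finally show "c * (y \<bullet> y) \<le> y \<bullet> (S *v y)" using S0[of y] by linarith
  qed
  show ?thesis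
  proof (rule that[OF \<delta>, folded S\<^sub>0_def])
    fix S assume S: "\<And>i j. \<bar>S $ i $ j - S\<^sub>0 $ i $ j\<bar> < \<delta>"
    obtain \<theta> where \<theta>: "\<theta> \<in> K" "\<And>\<phi>. \<phi> \<in> K \<Longrightarrow> ppca_loss S \<theta> \<le> ppca_loss S \<phi>"
      using continuous_attains_inf[OF K(1) _ loss_cont[of S]] \<theta>\<^sub>0K by blast
    \<comment> \<open>A minimiser over \<open>K\<close> is global: a competitor no worse than
      \<open>\<theta>\<^sub>0\<close> lies in \<open>K\<close>, and any other loses to
      \<open>\<theta>\<^sub>0\<close>, which is in \<open>K\<close>.\<close>
    have opt: "ppca_loss S \<theta> \<le> ppca_loss S \<phi>" if \<phi>: "\<phi> \<in> ppca_params" for \<phi> :: "(real^'q^'p) \<times> real"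
    proof (cases "ppca_loss S \<phi> \<le> ppca_loss S \<theta>\<^sub>0")
      case True
      show ?thesis by (rule \<theta>(2)[OF inK[OF S \<phi> True]])
    next
      case False
      then show ?thesis using \<theta>(2)[OF \<theta>\<^sub>0K] by linarith
    qed
    have "\<theta> \<in> ppca_params" using \<theta>(1) K(2) by (rule subsetD[rotated])
    then show "\<exists>\<theta>::(real^'q^'p) \<times> real. \<theta> \<in> ppca_params \<and> (\<forall>\<phi>\<in>ppca_params. ppca_loss S \<theta> \<le> ppca_loss S (\<phi> :: (real^'q^'p) \<times> real))"
      by (intro exI[of _ \<theta>] conjI ballI opt)
  next
    fix S and \<theta> :: "(real^'q^'p) \<times> real"
    assume S: "\<And>i j. \<bar>S $ i $ j - S\<^sub>0 $ i $ j\<bar> < \<delta>" and \<theta>: "\<theta> \<in> ppca_params"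
      and le: "ppca_loss S \<theta> \<le> ppca_loss S \<theta>\<^sub>0"
    have \<theta>K: "\<theta> \<in> K" by (rule inK[OF S \<theta> le])
    show "infdist \<theta> (ppca_fiber \<theta>\<^sub>0) < \<epsilon>"
    proof (rule ccontr)
      assume "\<not> ?thesis"
      then have "\<theta> \<in> K'" using \<theta>K by (simp add: K'_def)
      from \<eta>(2)[OF this] show False
        using perturb[OF S \<theta>K] perturb[OF S \<theta>\<^sub>0K] le \<eta>(1) by linarith
    qed
  qed
qed

section \<open>From the likelihood to the loss\<close>

lemma sum_quadratic_form_sample_cov:
  assumes "n \<ge> 1"
  shows "(\<Sum>i=1..n. x i \<bullet> (A *v x i)) = real n * trace (A ** sample_cov x n)"
proof -
  have "(\<Sum>i=1..n. x i \<bullet> (A *v x i)) = (\<Sum>i=1..n. \<Sum>a\<in>UNIV. \<Sum>b\<in>UNIV. A $ a $ b * (x i $ b * x i $ a))"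
    by (simp add: inner_vec_def matrix_vector_mult_def sum_distrib_left mult_ac)
  also have "\<dots> = (\<Sum>a\<in>UNIV. \<Sum>i=1..n. \<Sum>b\<in>UNIV. A $ a $ b * (x i $ b * x i $ a))"
    by (rule sum.swap)
  also have "\<dots> = (\<Sum>a\<in>UNIV. \<Sum>b\<in>UNIV. \<Sum>i=1..n. A $ a $ b * (x i $ b * x i $ a))"
    by (intro sum.cong refl sum.swap)
  also have "\<dots> = (\<Sum>a\<in>UNIV. \<Sum>b\<in>UNIV. real n * (A $ a $ b * sample_cov x n $ b $ a))"
  proof (intro sum.cong refl)
    fix a b
    have "(\<Sum>i=1..n. x i $ b * x i $ a) = real n * sample_cov x n $ b $ a"
      using assms by (simp add: sample_cov_def)
    then have "A $ a $ b * (\<Sum>i=1..n. x i $ b * x i $ a) = A $ a $ b * (real n * sample_cov x n $ b $ a)"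
      by simp
    then show "(\<Sum>i=1..n. A $ a $ b * (x i $ b * x i $ a)) = real n * (A $ a $ b * sample_cov x n $ b $ a)"
      unfolding sum_distrib_left[symmetric] by (simp only: mult.left_commute)
  qed
  also have "\<dots> = real n * trace (A ** sample_cov x n)"
    by (simp add: trace_def matrix_matrix_mult_def sum_distrib_left)
  finally show ?thesis .
qed

lemma mvn_density_eq_exp:
  fixes S :: "real^'k^'k"
  assumes "det S > 0"
  shows "mvn_density 0 S x
    = exp (- (x \<bullet> (matrix_inv S *v x) + ln (det S) + real CARD('k) * ln (2 * pi)) / 2)"
proof -
  have "sqrt ((2 * pi) ^ CARD('k) * det S) = exp (ln ((2 * pi) ^ CARD('k) * det S) / 2)"
    using assms by (simp add: powr_half_sqrt[symmetric] powr_def)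
  also have "ln ((2 * pi) ^ CARD('k) * det S) = real CARD('k) * ln (2 * pi) + ln (det S)"
    using assms by (simp add: ln_mult ln_realpow algebra_simps)
  finally show ?thesis
    by (simp add: mvn_density_def exp_diff[symmetric] field_simps)
qed

lemma ppca_likelihood_eq_exp:
  fixes \<theta> :: "(real^'q^'p) \<times> real"
  assumes "\<theta> \<in> ppca_params" "n \<ge> 1"
  shows "ppca_likelihood x n \<theta>
    = exp (- (real n * (ppca_loss (sample_cov x n) \<theta> + real CARD('p) * ln (2 * pi))) / 2)"
proof -
  have "det (ppca_cov \<theta>) > 0" using assms ppca_cov_pos_def pos_def_det_pos by blast
  then have "ppca_likelihood x n \<theta> = exp (\<Sum>i=1..n. - (x i \<bullet> (matrix_inv (ppca_cov \<theta>) *v x i)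
      + ln (det (ppca_cov \<theta>)) + real CARD('p) * ln (2 * pi)) / 2)"
    unfolding ppca_likelihood_def ppca_density_def by (simp add: mvn_density_eq_exp exp_sum)
  also have "(\<Sum>i=1..n. - (x i \<bullet> (matrix_inv (ppca_cov \<theta>) *v x i)
      + ln (det (ppca_cov \<theta>)) + real CARD('p) * ln (2 * pi)) / 2)
    = - ((\<Sum>i=1..n. x i \<bullet> (matrix_inv (ppca_cov \<theta>) *v x i))
      + real n * (ln (det (ppca_cov \<theta>)) + real CARD('p) * ln (2 * pi))) / 2"
    by (simp add: sum_divide_distrib[symmetric] sum_negf sum.distrib sum_subtractf algebra_simps)
  finally show ?thesis
    unfolding sum_quadratic_form_sample_cov[OF assms(2)] ppca_loss_def by (simp add: algebra_simps)
qed

text \<open>The factor \<open>real n\<close> in the exponent is positive for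
  \<open>n \<ge> 1\<close>. At \<open>n = 0\<close> the likelihood is the empty product, which every
  parameter maximises.\<close>

lemma is_ppca_mle_iff:
  fixes \<theta> :: "(real^'q^'p) \<times> real"
  assumes "n \<ge> 1"
  shows "is_ppca_mle x n \<theta> \<longleftrightarrow> \<theta> \<in> ppca_params \<and>
    (\<forall>\<phi>\<in>ppca_params. ppca_loss (sample_cov x n) \<theta> \<le> ppca_loss (sample_cov x n) (\<phi> :: (real^'q^'p) \<times> real))"
  using assms unfolding is_ppca_mle_def
  by (auto simp: ppca_likelihood_eq_exp mult_le_cancel_left_pos)

section \<open>Gaussian moments\<close>

lemma power_le_fact_mult_exp:
  fixes x :: real
  assumes "x \<ge> 0"
  shows "x ^ k \<le> fact k * exp x"
proof -
  have "(\<Sum>n\<in>{k}. x ^ n /\<^sub>R fact n) \<le> (\<Sum>n. x ^ n /\<^sub>R fact n)"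
    by (rule sum_le_suminf[OF summable_exp_generic]) (use assms in auto)
  then have "x ^ k / fact k \<le> exp x" by (simp add: exp_def divide_inverse mult.commute)
  then show ?thesis by (simp add: divide_le_eq mult.commute)
qed

text \<open>The left side equals \<open>exp x * (1 - exp (- x))\<^sup>2\<close>, and
  \<open>1 - exp (- x)\<close> lies between 0 and \<open>x\<close> for \<open>x \<ge> 0\<close>; the
  other sign follows by symmetry. It dominates difference quotients of the moment generating
  function.\<close>

lemma exp_second_difference_le:
  fixes x :: real
  shows "exp x + exp (- x) - 2 \<le> x\<^sup>2 * (exp x + exp (- x))"
proof -
  have *: "exp x + exp (- x) - 2 \<le> x\<^sup>2 * exp x" if "x \<ge> 0" for x :: real
  proof -
    have "1 - exp (- x) \<le> x" using exp_ge_add_one_self[of "- x"] by linarith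
    then have "(1 - exp (- x))\<^sup>2 \<le> x\<^sup>2" using that by (intro power_mono) auto
    then have "exp x * (1 - exp (- x))\<^sup>2 \<le> exp x * x\<^sup>2" by (intro mult_left_mono) auto
    moreover have "exp x * (1 - exp (- x))\<^sup>2 = exp x + exp (- x) - 2"
      by (simp add: exp_minus power2_eq_square field_simps)
    ultimately show ?thesis by (simp add: mult.commute)
  qed
  show ?thesis
  proof (cases "x \<ge> 0")
    case True
    have "x\<^sup>2 * exp x \<le> x\<^sup>2 * (exp x + exp (- x))" by (intro mult_left_mono) auto
    then show ?thesis using *[OF True] by linarith
  next
    case False
    have "x\<^sup>2 * exp (- x) \<le> x\<^sup>2 * (exp x + exp (- x))" by (intro mult_left_mono) auto
    moreover have "exp (- x) + exp x - 2 \<le> x\<^sup>2 * exp (- x)" using *[of "- x"] False by simp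
    ultimately show ?thesis by linarith
  qed
qed

text \<open>Completing the square turns the exponential tilt into a translation, so moment generating
  functions only need translation invariance of Lebesgue measure.\<close>

lemma mvn_density_exp_tilt:
  fixes S :: "real^'k^'k"
  assumes "pos_def S"
  shows "exp (u \<bullet> x) * mvn_density 0 S x = exp (u \<bullet> (S *v u) / 2) * mvn_density 0 S (x - S *v u)"
proof -
  define P where "P = matrix_inv S"
  have "det S \<noteq> 0" using pos_def_det_pos[OF assms] by simp
  then have SP: "S ** P = mat 1" "P ** S = mat 1"
    using matrix_inv_mult_right matrix_left_right_inverse unfolding P_def by blast+
  have 1: "P *v (S *v y) = y" "S *v (P *v y) = y" for y
    by (simp_all add: matrix_vector_mul_assoc SP)
  have sym: "(S *v y) \<bullet> z = y \<bullet> (S *v z)" for y z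
    using mult_matrix_vector_inner[of y S z] assms by (metis pos_def_def)
  have "(x - S *v u) \<bullet> (P *v (x - S *v u)) = x \<bullet> (P *v x) - 2 * (u \<bullet> x) + u \<bullet> (S *v u)"
    by (simp add: matrix_vector_mult_diff_distrib 1 inner_diff_left inner_diff_right sym inner_commute[of x u])
  then show ?thesis
    by (simp add: mvn_density_def P_def[symmetric] exp_add[symmetric] exp_diff[symmetric] field_simps)
qed


lemma mvn_density_nonneg:
  assumes "pos_def S"
  shows "mvn_density \<mu> S x \<ge> 0"
  using pos_def_det_pos[OF assms] by (simp add: mvn_density_def)

lemma continuous_on_mvn_density:
  assumes "pos_def S"
  shows "continuous_on T (mvn_density \<mu> S)"
proof -
  have "det S \<noteq> 0" using pos_def_det_pos[OF assms] by simp
  moreover have "continuous_on T (\<lambda>x. matrix_inv S *v (x - \<mu>))"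
    by (intro bounded_linear.continuous_on[OF matrix_vector_mul_bounded_linear] continuous_on_diff continuous_on_id continuous_on_const)
  ultimately show ?thesis unfolding mvn_density_def[abs_def] by (intro continuous_intros) auto
qed

lemma borel_measurable_mvn_density:
  "pos_def S \<Longrightarrow> mvn_density \<mu> S \<in> borel_measurable borel"
  by (intro borel_measurable_continuous_onI continuous_on_mvn_density)

lemma nn_integral_lborel_minus:
  fixes f :: "'a::euclidean_space \<Rightarrow> ennreal"
  assumes [measurable]: "f \<in> borel_measurable borel"
  shows "(\<integral>\<^sup>+x. f (x - c) \<partial>lborel) = (\<integral>\<^sup>+x. f x \<partial>lborel)"
proof -
  have "(\<integral>\<^sup>+x. f x \<partial>lborel) = (\<integral>\<^sup>+x. f x \<partial>distr lborel borel ((+) (- c)))"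
    by (simp only: lborel_distr_plus)
  also have "\<dots> = (\<integral>\<^sup>+x. f (- c + x) \<partial>lborel)"
    by (rule nn_integral_distr) auto
  finally show ?thesis by simp
qed

context prob_space
begin

text \<open>The Gaussian integral is never evaluated: after the tilt has become a translation, the
  remaining integral is the total mass of the law of \<open>X\<close>, which is 1 because
  \<open>M\<close> is a probability space.\<close>

lemma mvn_exp_moment:
  fixes X :: "'a \<Rightarrow> real^'k"
  assumes S: "pos_def S" and D: "distributed M lborel X (\<lambda>x. ennreal (mvn_density 0 S x))"
  shows "integrable M (\<lambda>\<omega>. exp (u \<bullet> X \<omega>))" "expectation (\<lambda>\<omega>. exp (u \<bullet> X \<omega>)) = exp (u \<bullet> (S *v u) / 2)"
proof -
  have X[measurable]: "X \<in> borel_measurable M"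
    using distributed_measurable[OF D] by simp
  note [measurable] = borel_measurable_mvn_density[OF S]
  have "(\<integral>\<^sup>+\<omega>. exp (u \<bullet> X \<omega>) \<partial>M) = (\<integral>\<^sup>+x. ennreal (mvn_density 0 S x) * ennreal (exp (u \<bullet> x)) \<partial>lborel)"
    by (rule distributed_nn_integral[OF D, symmetric]) simp
  also have "\<dots> = (\<integral>\<^sup>+x. ennreal (exp (u \<bullet> (S *v u) / 2)) * ennreal (mvn_density 0 S (x - S *v u)) \<partial>lborel)"
  proof (rule nn_integral_cong)
    fix x :: "real^'k"
    have "ennreal (mvn_density 0 S x) * ennreal (exp (u \<bullet> x)) = ennreal (exp (u \<bullet> x) * mvn_density 0 S x)"
      by (simp add: ennreal_mult mvn_density_nonneg[OF S] mult.commute)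
    also have "\<dots> = ennreal (exp (u \<bullet> (S *v u) / 2) * mvn_density 0 S (x - S *v u))"
      by (rule arg_cong[OF mvn_density_exp_tilt[OF S]])
    also have "\<dots> = ennreal (exp (u \<bullet> (S *v u) / 2)) * ennreal (mvn_density 0 S (x - S *v u))"
      by (rule ennreal_mult) (simp_all add: mvn_density_nonneg[OF S])
    finally show "ennreal (mvn_density 0 S x) * ennreal (exp (u \<bullet> x))
        = ennreal (exp (u \<bullet> (S *v u) / 2)) * ennreal (mvn_density 0 S (x - S *v u))" .
  qed
  also have "\<dots> = ennreal (exp (u \<bullet> (S *v u) / 2)) * (\<integral>\<^sup>+x. ennreal (mvn_density 0 S (x - S *v u)) \<partial>lborel)"
    by (rule nn_integral_cmult) simp
  also have "(\<integral>\<^sup>+x. ennreal (mvn_density 0 S (x - S *v u)) \<partial>lborel) = (\<integral>\<^sup>+x. ennreal (mvn_density 0 S x) \<partial>lborel)"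
    by (rule nn_integral_lborel_minus) simp
  also have "\<dots> = 1"
    using distributed_nn_integral[OF D, of "\<lambda>_. 1"] by (simp add: emeasure_space_1)
  finally have nn: "(\<integral>\<^sup>+\<omega>. exp (u \<bullet> X \<omega>) \<partial>M) = ennreal (exp (u \<bullet> (S *v u) / 2))" by simp
  show "integrable M (\<lambda>\<omega>. exp (u \<bullet> X \<omega>))"
    by (rule integrableI_nonneg) (simp_all add: nn)
  show "expectation (\<lambda>\<omega>. exp (u \<bullet> X \<omega>)) = exp (u \<bullet> (S *v u) / 2)"
    by (subst integral_eq_nn_integral) (simp_all add: nn)
qed

lemma integrable_power_of_exp:
  fixes Y :: "'a \<Rightarrow> real"
  assumes [measurable]: "Y \<in> borel_measurable M"
    and int: "\<And>t. integrable M (\<lambda>\<omega>. exp (t * Y \<omega>))"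
  shows "integrable M (\<lambda>\<omega>. Y \<omega> ^ k)"
proof (rule Bochner_Integration.integrable_bound)
  show "integrable M (\<lambda>\<omega>. fact k * (exp (1 * Y \<omega>) + exp (- 1 * Y \<omega>)))"
    by (intro integrable_mult_right Bochner_Integration.integrable_add int)
  show "AE \<omega> in M. norm (Y \<omega> ^ k) \<le> norm (fact k * (exp (1 * Y \<omega>) + exp (- 1 * Y \<omega>)))"
  proof (rule AE_I2)
    fix \<omega>
    have "norm (Y \<omega> ^ k) = \<bar>Y \<omega>\<bar> ^ k" by (simp add: power_abs)
    also have "\<dots> \<le> fact k * exp \<bar>Y \<omega>\<bar>" by (rule power_le_fact_mult_exp) simp
    also have "\<dots> \<le> fact k * (exp (1 * Y \<omega>) + exp (- 1 * Y \<omega>))"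
      by (intro mult_left_mono) (auto simp: abs_if)
    finally show "norm (Y \<omega> ^ k) \<le> norm (fact k * (exp (1 * Y \<omega>) + exp (- 1 * Y \<omega>)))" by simp
  qed
qed simp

text \<open>The second moment is the second derivative of the moment generating function at 0, taken
  as a limit of symmetric second difference quotients. Symmetry cancels the first-order term, so the
  mean does not appear.\<close>

lemma second_moment_of_exp_moments:
  fixes Y :: "'a \<Rightarrow> real"
  assumes [measurable]: "Y \<in> borel_measurable M"
    and int: "\<And>t. integrable M (\<lambda>\<omega>. exp (t * Y \<omega>))"
    and mgf: "\<And>t. expectation (\<lambda>\<omega>. exp (t * Y \<omega>)) = exp (t\<^sup>2 * v / 2)"
  shows "expectation (\<lambda>\<omega>. (Y \<omega>)\<^sup>2) = v"
proof -
  define s :: "nat \<Rightarrow> real" where "s n = 1 / real (Suc n)" for n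
  define D where "D n \<omega> = (exp (s n * Y \<omega>) + exp (- s n * Y \<omega>) - 2) / (s n)\<^sup>2" for n \<omega>
  have s: "0 < s n" "s n \<le> 1" for n by (simp_all add: s_def)
  \<comment> \<open>For step sizes at most 1 the quotient is at most
    \<open>y\<^sup>2 * (2 * exp \<bar>y\<bar>)\<close>. With
    \<open>y\<^sup>2 \<le> 2 * exp \<bar>y\<bar>\<close> this becomes
    \<open>4 * exp (2 * \<bar>y\<bar>)\<close>, which gives the dominating function.\<close>
  have "(\<lambda>n. expectation (D n)) \<longlonglongrightarrow> expectation (\<lambda>\<omega>. (Y \<omega>)\<^sup>2)"
  proof (rule integral_dominated_convergence[where w="\<lambda>\<omega>. 4 * (exp (2 * Y \<omega>) + exp (- 2 * Y \<omega>))"])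
    show "integrable M (\<lambda>\<omega>. 4 * (exp (2 * Y \<omega>) + exp (- 2 * Y \<omega>)))"
      by (intro integrable_mult_right Bochner_Integration.integrable_add int)
    have "(\<lambda>n. (exp (s n * y) + exp (- s n * y) - 2) / (s n)\<^sup>2) \<longlonglongrightarrow> y\<^sup>2" for y
      unfolding s_def by (real_asymp simp: power2_eq_square)
    then show "AE \<omega> in M. (\<lambda>n. D n \<omega>) \<longlonglongrightarrow> (Y \<omega>)\<^sup>2" unfolding D_def by blast
    fix n
    show "AE \<omega> in M. norm (D n \<omega>) \<le> 4 * (exp (2 * Y \<omega>) + exp (- 2 * Y \<omega>))"
    proof (rule AE_I2)
      fix \<omega>
      define y where "y = Y \<omega>"
      have "exp (s n * y) + exp (- s n * y) \<ge> 2"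
        using arith_geo_mean_sqrt[of "exp (s n * y)" "exp (- s n * y)"]
        by (simp add: exp_minus)
      then have "norm (D n \<omega>) = D n \<omega>" by (simp add: D_def y_def)
      also have "\<dots> \<le> (s n * y)\<^sup>2 * (exp (s n * y) + exp (- (s n * y))) / (s n)\<^sup>2"
        unfolding D_def y_def[symmetric]
        using exp_second_difference_le[of "s n * y"] by (intro divide_right_mono) auto
      also have "\<dots> = y\<^sup>2 * (exp (s n * y) + exp (- (s n * y)))"
        using s(1)[of n] by (simp add: power_mult_distrib)
      also have "\<dots> \<le> (2 * exp \<bar>y\<bar>) * (2 * exp \<bar>y\<bar>)"
      proof (intro mult_mono)
        show "y\<^sup>2 \<le> 2 * exp \<bar>y\<bar>" using power_le_fact_mult_exp[of "\<bar>y\<bar>" 2] by simp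
        have "\<bar>s n * y\<bar> \<le> \<bar>y\<bar>"
          using mult_right_mono[OF s(2)[of n], of "\<bar>y\<bar>"] s(1)[of n] by (simp add: abs_mult)
        then have "exp (s n * y) \<le> exp \<bar>y\<bar>" "exp (- (s n * y)) \<le> exp \<bar>y\<bar>" by auto
        then show "exp (s n * y) + exp (- (s n * y)) \<le> 2 * exp \<bar>y\<bar>" by linarith
      qed auto
      also have "\<dots> = 4 * exp (2 * \<bar>y\<bar>)" by (simp add: exp_double power2_eq_square)
      also have "\<dots> \<le> 4 * (exp (2 * y) + exp (- 2 * y))" by (simp add: abs_if)
      finally show "norm (D n \<omega>) \<le> 4 * (exp (2 * Y \<omega>) + exp (- 2 * Y \<omega>))" by (simp add: y_def)
    qed
  qed (simp_all add: D_def[abs_def])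
  moreover have "expectation (D n) = (2 * exp ((s n)\<^sup>2 * v / 2) - 2) / (s n)\<^sup>2" for n
    unfolding D_def using int[of "s n"] int[of "- s n"] mgf[of "s n"] mgf[of "- s n"]
    by (simp add: prob_space)
  moreover have "(\<lambda>n. (2 * exp ((s n)\<^sup>2 * v / 2) - 2) / (s n)\<^sup>2) \<longlonglongrightarrow> v"
    unfolding s_def by real_asymp
  ultimately show ?thesis by (simp add: LIMSEQ_unique)
qed

end

section \<open>Strong law for second-moment matrices\<close>

lemma integrable_lower_power:
  fixes Y :: "'a \<Rightarrow> real"
  assumes "finite_measure M" and [measurable]: "Y \<in> borel_measurable M"
    and int: "integrable M (\<lambda>\<omega>. Y \<omega> ^ n)" and "k \<le> n" "even n"
  shows "integrable M (\<lambda>\<omega>. Y \<omega> ^ k)"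
proof (rule Bochner_Integration.integrable_bound)
  show "integrable M (\<lambda>\<omega>. 1 + Y \<omega> ^ n)"
    using int finite_measure.integrable_const[OF assms(1)] by (intro Bochner_Integration.integrable_add) auto
  show "AE \<omega> in M. norm (Y \<omega> ^ k) \<le> norm (1 + Y \<omega> ^ n)"
  proof (rule AE_I2)
    fix \<omega>
    have "\<bar>Y \<omega>\<bar> ^ k \<le> 1 + \<bar>Y \<omega>\<bar> ^ n"
    proof (cases "\<bar>Y \<omega>\<bar> \<le> 1")
      case True
      then have "\<bar>Y \<omega>\<bar> ^ k \<le> 1" by (intro power_le_one) auto
      then show ?thesis by (simp add: add_increasing2)
    next
      case False
      then have "\<bar>Y \<omega>\<bar> ^ k \<le> \<bar>Y \<omega>\<bar> ^ n" using \<open>k \<le> n\<close> by (intro power_increasing) auto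
      then show ?thesis by simp
    qed
    then show "norm (Y \<omega> ^ k) \<le> norm (1 + Y \<omega> ^ n)"
      using \<open>even n\<close> by (simp add: power_abs power_even_abs)
  qed
qed simp

context prob_space
begin

text \<open>Induction on \<open>n\<close>, carrying the four claims together. In the expansion of
  \<open>(t + z) ^ 4\<close> the terms with a first power factor vanish by independence and mean 0;
  the surviving mixed term involves second moments only, so the fourth moment grows like
  \<open>n^2\<close> instead of \<open>n^4\<close>.\<close>

lemma fourth_moment_indep_sum:
  fixes Z :: "nat \<Rightarrow> 'a \<Rightarrow> real"
  assumes indep: "indep_vars (\<lambda>_. borel) Z {1..}"
    and int: "\<And>i. i \<ge> 1 \<Longrightarrow> integrable M (\<lambda>\<omega>. Z i \<omega> ^ 4)"
    and mean: "\<And>i. i \<ge> 1 \<Longrightarrow> expectation (Z i) = 0"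
    and a: "\<And>i. i \<ge> 1 \<Longrightarrow> expectation (\<lambda>\<omega>. Z i \<omega> ^ 2) \<le> a"
    and b: "\<And>i. i \<ge> 1 \<Longrightarrow> expectation (\<lambda>\<omega>. Z i \<omega> ^ 4) \<le> b"
  defines "T \<equiv> \<lambda>n \<omega>. \<Sum>i=1..n. Z i \<omega>"
  shows "integrable M (\<lambda>\<omega>. T n \<omega> ^ 4)" "expectation (T n) = 0"
    "expectation (\<lambda>\<omega>. T n \<omega> ^ 2) \<le> real n * a"
    "expectation (\<lambda>\<omega>. T n \<omega> ^ 4) \<le> real n * b + 3 * (real n)\<^sup>2 * a\<^sup>2"
proof -
  have Zm: "Z i \<in> borel_measurable M" if "i \<ge> 1" for i
    using indep that unfolding indep_vars_def by auto
  have Tm: "T n \<in> borel_measurable M" for n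
    unfolding T_def by (intro borel_measurable_sum Zm) auto
  have a0: "a \<ge> 0" by (rule order_trans[OF _ a[OF order_refl]]) simp
  have "integrable M (\<lambda>\<omega>. T n \<omega> ^ 4) \<and> expectation (T n) = 0 \<and>
    expectation (\<lambda>\<omega>. T n \<omega> ^ 2) \<le> real n * a \<and>
    expectation (\<lambda>\<omega>. T n \<omega> ^ 4) \<le> real n * b + 3 * (real n)\<^sup>2 * a\<^sup>2"
  proof (induction n)
    case 0
    show ?case by (simp add: T_def)
  next
    case (Suc n)
    define z where "z = Z (Suc n)"
    define t where "t = T n"
    have zt: "T (Suc n) = (\<lambda>\<omega>. t \<omega> + z \<omega>)" by (simp add: T_def z_def t_def fun_eq_iff)
    have zm: "z \<in> borel_measurable M" unfolding z_def by (rule Zm) simp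
    have tm: "t \<in> borel_measurable M" unfolding t_def by (rule Tm)
    have z_int: "integrable M (\<lambda>\<omega>. z \<omega> ^ k)" if "k \<le> 4" for k
      by (rule integrable_lower_power[OF _ zm _ that])
        (use int[of "Suc n"] in \<open>auto simp: z_def finite_measure_axioms\<close>)
    have t_int: "integrable M (\<lambda>\<omega>. t \<omega> ^ k)" if "k \<le> 4" for k
      by (rule integrable_lower_power[OF _ tm _ that])
        (use Suc.IH in \<open>auto simp: t_def finite_measure_axioms\<close>)
    have "indep_vars (\<lambda>_. borel) Z (insert (Suc n) {1..n})"
      by (rule indep_vars_subset[OF indep]) auto
    then have "indep_var borel z borel t"
      unfolding z_def t_def T_def by (intro indep_vars_sum) auto
    then have pow: "indep_var borel (\<lambda>\<omega>. z \<omega> ^ j) borel (\<lambda>\<omega>. t \<omega> ^ k)" for j k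
      using indep_var_compose[of borel z borel t "\<lambda>x. x ^ j" borel "\<lambda>x. x ^ k" borel]
      by (simp add: comp_def)
    have mix_int: "integrable M (\<lambda>\<omega>. z \<omega> ^ j * t \<omega> ^ k)" if "j \<le> 4" "k \<le> 4" for j k
      by (intro indep_var_integrable pow z_int t_int that)
    have mix: "expectation (\<lambda>\<omega>. z \<omega> ^ j * t \<omega> ^ k)
        = expectation (\<lambda>\<omega>. z \<omega> ^ j) * expectation (\<lambda>\<omega>. t \<omega> ^ k)" if "j \<le> 4" "k \<le> 4" for j k
      by (intro indep_var_lebesgue_integral pow z_int t_int that)
    have z1: "expectation (\<lambda>\<omega>. z \<omega> ^ 1) = 0" using mean[of "Suc n"] by (simp add: z_def)
    have t1: "expectation (\<lambda>\<omega>. t \<omega> ^ 1) = 0" using Suc.IH by (simp add: t_def)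
    have z2: "expectation (\<lambda>\<omega>. z \<omega> ^ 2) \<le> a" using a[of "Suc n"] by (simp add: z_def)
    have t2: "expectation (\<lambda>\<omega>. t \<omega> ^ 2) \<le> real n * a" using Suc.IH by (simp add: t_def)
    have z4: "expectation (\<lambda>\<omega>. z \<omega> ^ 4) \<le> b" using b[of "Suc n"] by (simp add: z_def)
    have t4: "expectation (\<lambda>\<omega>. t \<omega> ^ 4) \<le> real n * b + 3 * (real n)\<^sup>2 * a\<^sup>2" using Suc.IH by (simp add: t_def)
    \<comment> \<open>First powers are written as \<open>^ 1\<close> so that every mixed term is an
      instance of \<open>mix\<close> and \<open>mix_int\<close>.\<close>
    have exp2: "T (Suc n) \<omega> ^ 2 = t \<omega> ^ 2 + 2 * (z \<omega> ^ 1 * t \<omega> ^ 1) + z \<omega> ^ 2" for \<omega>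
      by (simp add: zt power2_eq_square algebra_simps)
    have exp4: "T (Suc n) \<omega> ^ 4 = t \<omega> ^ 4 + 4 * (z \<omega> ^ 1 * t \<omega> ^ 3) + 6 * (z \<omega> ^ 2 * t \<omega> ^ 2)
        + 4 * (z \<omega> ^ 3 * t \<omega> ^ 1) + z \<omega> ^ 4" for \<omega>
      by (simp add: zt eval_nat_numeral algebra_simps)
    have "expectation (T (Suc n)) = 0"
      using z_int[of 1] t_int[of 1] z1 t1 by (simp add: zt)
    moreover have "integrable M (\<lambda>\<omega>. T (Suc n) \<omega> ^ 4)"
      unfolding exp4 by (intro Bochner_Integration.integrable_add integrable_mult_right mix_int z_int t_int) auto
    moreover have "expectation (\<lambda>\<omega>. T (Suc n) \<omega> ^ 2)
        = expectation (\<lambda>\<omega>. t \<omega> ^ 2) + 2 * (expectation (\<lambda>\<omega>. z \<omega> ^ 1) * expectation (\<lambda>\<omega>. t \<omega> ^ 1))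
          + expectation (\<lambda>\<omega>. z \<omega> ^ 2)"
      unfolding exp2 using mix_int[of 1 1] mix[of 1 1] z_int[of 2] t_int[of 2] by simp
    then have "expectation (\<lambda>\<omega>. T (Suc n) \<omega> ^ 2) \<le> real (Suc n) * a"
      using z1 z2 t2 by (simp add: algebra_simps)
    moreover have "expectation (\<lambda>\<omega>. T (Suc n) \<omega> ^ 4)
        = expectation (\<lambda>\<omega>. t \<omega> ^ 4) + 4 * (expectation (\<lambda>\<omega>. z \<omega> ^ 1) * expectation (\<lambda>\<omega>. t \<omega> ^ 3))
          + 6 * (expectation (\<lambda>\<omega>. z \<omega> ^ 2) * expectation (\<lambda>\<omega>. t \<omega> ^ 2))
          + 4 * (expectation (\<lambda>\<omega>. z \<omega> ^ 3) * expectation (\<lambda>\<omega>. t \<omega> ^ 1))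
          + expectation (\<lambda>\<omega>. z \<omega> ^ 4)"
      unfolding exp4
      using mix_int[of 1 3] mix[of 1 3] mix_int[of 2 2] mix[of 2 2] mix_int[of 3 1] mix[of 3 1]
        z_int[of 4] t_int[of 4] by simp
    moreover have "expectation (\<lambda>\<omega>. z \<omega> ^ 2) * expectation (\<lambda>\<omega>. t \<omega> ^ 2) \<le> a * (real n * a)"
      by (intro mult_mono z2 t2 a0) simp
    \<comment> \<open>The constant 3 is what the induction needs: the mixed term adds
      \<open>6 * n * a\<^sup>2\<close>, while \<open>3 * n\<^sup>2 * a\<^sup>2\<close> grows by
      \<open>(6 * n + 3) * a\<^sup>2\<close>.\<close>
    moreover have "(real n * b + 3 * (real n)\<^sup>2 * a\<^sup>2) + 6 * (a * (real n * a)) + b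
        \<le> real (Suc n) * b + 3 * (real (Suc n))\<^sup>2 * a\<^sup>2"
      by (simp add: power2_eq_square algebra_simps)
    ultimately show ?case using z1 t1 z4 t4 by auto
  qed
  then show "integrable M (\<lambda>\<omega>. T n \<omega> ^ 4)" "expectation (T n) = 0"
    "expectation (\<lambda>\<omega>. T n \<omega> ^ 2) \<le> real n * a"
    "expectation (\<lambda>\<omega>. T n \<omega> ^ 4) \<le> real n * b + 3 * (real n)\<^sup>2 * a\<^sup>2" by auto
qed

text \<open>Markov's inequality for the fourth power of the sum bounds the probability by a constant
  times \<open>n^2 / (\<delta> * n)^4\<close>, which is of order \<open>1/n^2\<close>.\<close>

lemma summable_indep_mean_deviation:
  fixes Z :: "nat \<Rightarrow> 'a \<Rightarrow> real"
  assumes indep: "indep_vars (\<lambda>_. borel) Z {1..}"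
    and int: "\<And>i. i \<ge> 1 \<Longrightarrow> integrable M (\<lambda>\<omega>. Z i \<omega> ^ 4)"
    and mean: "\<And>i. i \<ge> 1 \<Longrightarrow> expectation (Z i) = 0"
    and a: "\<And>i. i \<ge> 1 \<Longrightarrow> expectation (\<lambda>\<omega>. Z i \<omega> ^ 2) \<le> a"
    and b: "\<And>i. i \<ge> 1 \<Longrightarrow> expectation (\<lambda>\<omega>. Z i \<omega> ^ 4) \<le> b"
    and \<delta>: "\<delta> > 0"
  shows "summable (\<lambda>n. prob {\<omega> \<in> space M. \<delta> \<le> \<bar>(\<Sum>i=1..n. Z i \<omega>) / real n\<bar>})"
proof (rule summable_comparison_test')
  show "summable (\<lambda>n. (b + 3 * a\<^sup>2) / \<delta> ^ 4 * inverse (real n ^ 2))"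
    by (intro summable_mult inverse_power_summable) simp
  fix n :: nat assume n: "1 \<le> n"
  define T where "T = (\<lambda>\<omega>. \<Sum>i=1..n. Z i \<omega>)"
  have T4: "integrable M (\<lambda>\<omega>. T \<omega> ^ 4)" "expectation (\<lambda>\<omega>. T \<omega> ^ 4) \<le> real n * b + 3 * (real n)\<^sup>2 * a\<^sup>2"
    using fourth_moment_indep_sum(1,4)[OF indep int mean a b] unfolding T_def by blast+
  have b0: "b \<ge> 0" by (rule order_trans[OF _ b[OF order_refl]]) simp
  have "{\<omega> \<in> space M. \<delta> \<le> \<bar>T \<omega> / real n\<bar>} = {\<omega> \<in> space M. (\<delta> * real n) ^ 4 \<le> T \<omega> ^ 4}"
  proof (intro Collect_cong conj_cong refl)
    fix \<omega>
    have "\<delta> \<le> \<bar>T \<omega> / real n\<bar> \<longleftrightarrow> \<delta> * real n \<le> \<bar>T \<omega>\<bar>" using n by (simp add: pos_le_divide_eq)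
    also have "\<dots> \<longleftrightarrow> (\<delta> * real n) ^ 4 \<le> \<bar>T \<omega>\<bar> ^ 4" using \<delta> by (subst power_mono_iff) auto
    finally show "\<delta> \<le> \<bar>T \<omega> / real n\<bar> \<longleftrightarrow> (\<delta> * real n) ^ 4 \<le> T \<omega> ^ 4" by (simp add: power_even_abs)
  qed
  then have "prob {\<omega> \<in> space M. \<delta> \<le> \<bar>T \<omega> / real n\<bar>} \<le> expectation (\<lambda>\<omega>. T \<omega> ^ 4) / (\<delta> * real n) ^ 4"
    using integral_Markov_inequality_measure[OF T4(1), of "{}" "(\<delta> * real n) ^ 4"] \<delta> n by simp
  also have "\<dots> \<le> ((b + 3 * a\<^sup>2) * (real n)\<^sup>2) / (\<delta> * real n) ^ 4"
  proof (intro divide_right_mono)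
    have "real n * b \<le> (real n)\<^sup>2 * b"
      using n b0 by (intro mult_right_mono) (auto simp: power2_eq_square)
    then show "expectation (\<lambda>\<omega>. T \<omega> ^ 4) \<le> (b + 3 * a\<^sup>2) * (real n)\<^sup>2"
      using T4(2) by (simp add: algebra_simps)
  qed (use \<delta> in simp)
  also have "\<dots> = (b + 3 * a\<^sup>2) / \<delta> ^ 4 * inverse (real n ^ 2)"
    using n \<delta> by (simp add: field_simps eval_nat_numeral)
  finally show "norm (prob {\<omega> \<in> space M. \<delta> \<le> \<bar>(\<Sum>i=1..n. Z i \<omega>) / real n\<bar>})
      \<le> (b + 3 * a\<^sup>2) / \<delta> ^ 4 * inverse (real n ^ 2)"
    by (simp add: T_def)
qed

end

section \<open>Moments of products of Gaussian coordinates\<close>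

lemma power4_diff_le:
  fixes x y :: real
  shows "(x - y) ^ 4 \<le> 8 * (x ^ 4 + y ^ 4)"
proof -
  have sq: "(u - v)\<^sup>2 \<le> 2 * (u\<^sup>2 + v\<^sup>2)" for u v :: real
    using zero_le_power2[of "u + v"] by (simp add: power2_sum power2_diff)
  have sq': "(u + v)\<^sup>2 \<le> 2 * (u\<^sup>2 + v\<^sup>2)" for u v :: real
    using zero_le_power2[of "u - v"] by (simp add: power2_sum power2_diff)
  have "(x - y) ^ 4 = ((x - y)\<^sup>2)\<^sup>2" by (simp flip: power_mult)
  also have "\<dots> \<le> (2 * (x\<^sup>2 + y\<^sup>2))\<^sup>2" by (intro power_mono sq) simp
  also have "\<dots> = 4 * (x\<^sup>2 + y\<^sup>2)\<^sup>2" by (subst power_mult_distrib) simp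
  also have "\<dots> \<le> 4 * (2 * ((x\<^sup>2)\<^sup>2 + (y\<^sup>2)\<^sup>2))" by (intro mult_left_mono sq') simp
  also have "\<dots> = 8 * (x ^ 4 + y ^ 4)" by (simp flip: power_mult)
  finally show ?thesis .
qed

lemma power4_mult_le:
  fixes x y :: real
  shows "(x * y) ^ 4 \<le> x ^ 8 + y ^ 8"
proof -
  have "2 * (x ^ 4 * y ^ 4) \<le> (x ^ 4)\<^sup>2 + (y ^ 4)\<^sup>2"
    using sum_squares_bound[of "x ^ 4" "y ^ 4"] by simp
  moreover have "0 \<le> x ^ 4 * y ^ 4" by simp
  ultimately have "x ^ 4 * y ^ 4 \<le> (x ^ 4)\<^sup>2 + (y ^ 4)\<^sup>2" by linarith
  then show ?thesis by (simp add: power_mult_distrib flip: power_mult)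
qed

context prob_space
begin

lemma mvn_moments:
  fixes X :: "'a \<Rightarrow> real^'k"
  assumes S: "pos_def S" and D: "distributed M lborel X (\<lambda>x. ennreal (mvn_density 0 S x))"
  shows integrable_mvn_power: "integrable M (\<lambda>\<omega>. (u \<bullet> X \<omega>) ^ n)"
    and mvn_second_moment: "expectation (\<lambda>\<omega>. (u \<bullet> X \<omega>)\<^sup>2) = u \<bullet> (S *v u)"
proof -
  have [measurable]: "X \<in> borel_measurable M" using distributed_measurable[OF D] by simp
  have int: "integrable M (\<lambda>\<omega>. exp (t * (u \<bullet> X \<omega>)))"
    and mgf: "expectation (\<lambda>\<omega>. exp (t * (u \<bullet> X \<omega>))) = exp (t\<^sup>2 * (u \<bullet> (S *v u)) / 2)" for t
    using mvn_exp_moment[OF S D, of "t *\<^sub>R u"]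
    by (simp_all add: matrix_vector_mult_scaleR power2_eq_square mult.assoc)
  show "integrable M (\<lambda>\<omega>. (u \<bullet> X \<omega>) ^ n)"
    by (rule integrable_power_of_exp[OF _ int]) simp
  show "expectation (\<lambda>\<omega>. (u \<bullet> X \<omega>)\<^sup>2) = u \<bullet> (S *v u)"
    by (rule second_moment_of_exp_moments[OF _ int mgf]) simp
qed

text \<open>Polarisation: mixed moments come from second moments in the directions
  \<open>e a + e b\<close>, \<open>e a\<close> and \<open>e b\<close>. Symmetry of \<open>S\<close>
  merges the two cross terms.\<close>

lemma mvn_covariance:
  fixes X :: "'a \<Rightarrow> real^'k"
  assumes S: "pos_def S" and D: "distributed M lborel X (\<lambda>x. ennreal (mvn_density 0 S x))"
  shows "integrable M (\<lambda>\<omega>. X \<omega> $ a * X \<omega> $ b)"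
    and "expectation (\<lambda>\<omega>. X \<omega> $ a * X \<omega> $ b) = S $ a $ b"
proof -
  define e :: "'k \<Rightarrow> real^'k" where "e i = axis i 1" for i
  have comp: "e i \<bullet> X \<omega> = X \<omega> $ i" for i \<omega> by (simp add: e_def inner_axis')
  have eSe: "e i \<bullet> (S *v e j) = S $ i $ j" for i j
    by (simp add: e_def inner_axis' matrix_vector_mult_basis column_def)
  have "transpose S $ a $ b = S $ a $ b" using S by (simp add: pos_def_def)
  then have sym: "S $ b $ a = S $ a $ b" by (simp add: transpose_def)
  have polar: "X \<omega> $ a * X \<omega> $ b
      = (((e a + e b) \<bullet> X \<omega>)\<^sup>2 - (e a \<bullet> X \<omega>)\<^sup>2 - (e b \<bullet> X \<omega>)\<^sup>2) / 2" for \<omega>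
    by (simp add: inner_add_left comp power2_sum)
  note int = integrable_mvn_power[OF S D, of _ 2]
  show "integrable M (\<lambda>\<omega>. X \<omega> $ a * X \<omega> $ b)"
    unfolding polar by (intro integrable_divide Bochner_Integration.integrable_diff int)
  show "expectation (\<lambda>\<omega>. X \<omega> $ a * X \<omega> $ b) = S $ a $ b"
  proof -
    have "expectation (\<lambda>\<omega>. X \<omega> $ a * X \<omega> $ b)
        = ((e a + e b) \<bullet> (S *v (e a + e b)) - e a \<bullet> (S *v e a) - e b \<bullet> (S *v e b)) / 2"
      unfolding polar using int mvn_second_moment[OF S D] by simp
    then show ?thesis
      by (simp add: inner_add_left inner_add_right matrix_vector_right_distrib eSe sym)
  qed
qed

text \<open>Fourth powers of products of two coordinates are dominated by eighth powers of the
  coordinates.\<close>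

lemma integrable_mvn_centered_product:
  fixes X :: "'a \<Rightarrow> real^'k"
  assumes S: "pos_def S" and D: "distributed M lborel X (\<lambda>x. ennreal (mvn_density 0 S x))"
  shows "integrable M (\<lambda>\<omega>. (X \<omega> $ a * X \<omega> $ b - c) ^ 4)"
proof (rule Bochner_Integration.integrable_bound)
  have [measurable]: "X \<in> borel_measurable M" using distributed_measurable[OF D] by simp
  have int: "integrable M (\<lambda>\<omega>. (X \<omega> $ i) ^ 8)" for i
    using integrable_mvn_power[OF S D, of "axis i 1" 8] by (simp add: inner_axis')
  show "integrable M (\<lambda>\<omega>. 8 * ((X \<omega> $ a) ^ 8 + (X \<omega> $ b) ^ 8 + c ^ 4))"
    by (intro integrable_mult_right Bochner_Integration.integrable_add int integrable_const)
  have [measurable]: "(\<lambda>x::real^'k. x $ i) \<in> borel_measurable borel" for i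
    by (intro borel_measurable_continuous_onI continuous_intros)
  show "(\<lambda>\<omega>. (X \<omega> $ a * X \<omega> $ b - c) ^ 4) \<in> borel_measurable M" by measurable
  show "AE \<omega> in M. norm ((X \<omega> $ a * X \<omega> $ b - c) ^ 4) \<le> norm (8 * ((X \<omega> $ a) ^ 8 + (X \<omega> $ b) ^ 8 + c ^ 4))"
  proof (rule AE_I2)
    fix \<omega>
    show "norm ((X \<omega> $ a * X \<omega> $ b - c) ^ 4) \<le> norm (8 * ((X \<omega> $ a) ^ 8 + (X \<omega> $ b) ^ 8 + c ^ 4))"
      using power4_diff_le[of "X \<omega> $ a * X \<omega> $ b" c] power4_mult_le[of "X \<omega> $ a" "X \<omega> $ b"] by simp
  qed
qed

text \<open>Each entry of the deviation is an average of independent centred variables with finite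
  fourth moment; a union bound over the finitely many entries keeps summability.\<close>

lemma sample_cov_deviation:
  fixes X :: "nat \<Rightarrow> 'a \<Rightarrow> real^'k"
  assumes S: "pos_def S" and indep: "indep_vars (\<lambda>_. borel) X {1..}"
    and D: "\<And>i. i \<ge> 1 \<Longrightarrow> distributed M lborel (X i) (\<lambda>x. ennreal (mvn_density 0 S x))"
    and \<delta>: "\<delta> > 0"
  defines "E \<equiv> \<lambda>n. {\<omega> \<in> space M. \<exists>a b. \<delta> \<le> \<bar>sample_cov (\<lambda>i. X i \<omega>) n $ a $ b - S $ a $ b\<bar>}"
  shows sets_sample_cov_deviation: "E n \<in> events"
    and summable_sample_cov_deviation: "summable (\<lambda>n. prob (E n))"
proof -
  have Xm: "X i \<in> borel_measurable M" if "i \<ge> 1" for i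
    using distributed_measurable[OF D[OF that]] by simp
  have "(\<lambda>\<omega>. X i \<omega> $ a) \<in> borel_measurable M" if "i \<ge> 1" for i a
    by (rule measurable_compose[OF Xm[OF that]]) simp
  then have cov_m: "(\<lambda>\<omega>. sample_cov (\<lambda>i. X i \<omega>) n $ a $ b) \<in> borel_measurable M" for n a b
    unfolding sample_cov_def vec_lambda_beta
    by (intro borel_measurable_divide borel_measurable_sum borel_measurable_times) auto
  define F where "F a b n = {\<omega> \<in> space M. \<delta> \<le> \<bar>sample_cov (\<lambda>i. X i \<omega>) n $ a $ b - S $ a $ b\<bar>}" for a b n
  have F: "F a b n \<in> events" for a b n
    unfolding F_def using cov_m[of n a b] by measurable
  have EF: "E n = (\<Union>a. \<Union>b. F a b n)" for n by (auto simp: E_def F_def)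
  show E: "E n \<in> events" for n unfolding EF by (intro sets.finite_UN F) auto
  have summable_F: "summable (\<lambda>n. prob (F a b n))" for a b
  proof -
    define h where "h x = x $ a * x $ b - S $ a $ b" for x :: "real^'k"
    have hm: "h \<in> borel_measurable borel"
      unfolding h_def by (intro borel_measurable_continuous_onI continuous_intros)
    \<comment> \<open>Written as integrals against the common density, the moments no longer depend
      on \<open>i\<close>; they serve as the uniform bounds on second and fourth moments.\<close>
    have same: "expectation (\<lambda>\<omega>. h (X i \<omega>) ^ k) = (\<integral>x. mvn_density 0 S x * h x ^ k \<partial>lborel)"
      if "i \<ge> 1" for i k
      by (rule distributed_integral[OF D[OF that], symmetric])
        (use hm mvn_density_nonneg[OF S] in auto)
    have "summable (\<lambda>n. prob {\<omega> \<in> space M. \<delta> \<le> \<bar>(\<Sum>i=1..n. h (X i \<omega>)) / real n\<bar>})"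
    proof (rule summable_indep_mean_deviation)
      show "indep_vars (\<lambda>_. borel) (\<lambda>i \<omega>. h (X i \<omega>)) {1..}"
        by (rule indep_vars_compose2[OF indep]) (rule hm)
      show "integrable M (\<lambda>\<omega>. h (X i \<omega>) ^ 4)" if "i \<ge> 1" for i
        unfolding h_def by (rule integrable_mvn_centered_product[OF S D[OF that]])
      show "expectation (\<lambda>\<omega>. h (X i \<omega>)) = 0" if "i \<ge> 1" for i
        unfolding h_def using mvn_covariance[OF S D[OF that], of a b] by (simp add: prob_space)
      show "expectation (\<lambda>\<omega>. h (X i \<omega>) ^ 2) \<le> (\<integral>x. mvn_density 0 S x * h x ^ 2 \<partial>lborel)"
        "expectation (\<lambda>\<omega>. h (X i \<omega>) ^ 4) \<le> (\<integral>x. mvn_density 0 S x * h x ^ 4 \<partial>lborel)" if "i \<ge> 1" for i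
        using same[OF that] by simp_all
    qed (rule \<delta>)
    moreover have "(\<Sum>i=1..n. h (X i \<omega>)) / real n = sample_cov (\<lambda>i. X i \<omega>) n $ a $ b - S $ a $ b"
      if "n \<ge> 1" for n \<omega>
      using that by (simp add: h_def sample_cov_def sum_subtractf diff_divide_distrib)
    \<comment> \<open>Agreement holds from \<open>n = 1\<close> on: at \<open>n = 0\<close> division
      by zero makes the average 0, but the sample entry minus \<open>S $ a $ b\<close> need not
      be.\<close>
    then have "\<forall>\<^sub>F n in sequentially. prob {\<omega> \<in> space M. \<delta> \<le> \<bar>(\<Sum>i=1..n. h (X i \<omega>)) / real n\<bar>} = prob (F a b n)"
      unfolding F_def by (intro eventually_sequentiallyI[of 1]) simp
    ultimately show ?thesis by (simp only: summable_cong)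
  qed
  show "summable (\<lambda>n. prob (E n))"
  proof (rule summable_comparison_test')
    show "summable (\<lambda>n. \<Sum>a\<in>UNIV. \<Sum>b\<in>UNIV. prob (F a b n))"
      by (intro summable_sum summable_F)
    have "prob (E n) \<le> (\<Sum>a\<in>UNIV. prob (\<Union>b. F a b n))" for n
      unfolding EF by (rule finite_measure_subadditive_finite) (use F in auto)
    also have "(\<Sum>a\<in>UNIV. prob (\<Union>b. F a b n)) \<le> (\<Sum>a\<in>UNIV. \<Sum>b\<in>UNIV. prob (F a b n))" for n
      by (intro sum_mono finite_measure_subadditive_finite) (use F in auto)
    finally show "norm (prob (E n)) \<le> (\<Sum>a\<in>UNIV. \<Sum>b\<in>UNIV. prob (F a b n))" for n by simp
  qed
qed

end

section \<open>Consistency\<close>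

text \<open>\<open>\<theta>\<^sub>0\<close> lies in the collapsed set, so the second branch of the
  minimum is just the distance of \<open>\<theta>\<close> to the fibre. The rotation of the loadings
  that the likelihood leaves free thus does no harm.\<close>

lemma collapse_dist_ppca_fiber_le:
  fixes \<theta> \<theta>\<^sub>0 :: "(real^'q^'p) \<times> real"
  assumes "\<theta> \<in> ppca_params" "\<theta>\<^sub>0 \<in> ppca_params"
  shows "collapse_dist (ppca_fiber \<theta>\<^sub>0) (collapse_class ppca_params (ppca_fiber \<theta>\<^sub>0) \<theta>)
      (collapse_class ppca_params (ppca_fiber \<theta>\<^sub>0) \<theta>\<^sub>0) \<le> infdist \<theta> (ppca_fiber \<theta>\<^sub>0)"
proof -
  have "ppca_fiber \<theta>\<^sub>0 \<subseteq> ppca_params" "\<theta>\<^sub>0 \<in> ppca_fiber \<theta>\<^sub>0"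
    using assms by (auto simp: ppca_fiber_def)
  then show ?thesis using assms by (simp add: collapse_dist_class)
qed

theorem corollary5p3:
  fixes M :: "'w measure"
    and X :: "nat \<Rightarrow> 'w \<Rightarrow> real^'p"
    and \<theta>\<^sub>0 :: "(real^'q^'p) \<times> real"
    and \<theta> :: "nat \<Rightarrow> 'w \<Rightarrow> (real^'q^'p) \<times> real"
  assumes "CARD('q) < CARD('p)"
    and "prob_space M"
    and "\<theta>\<^sub>0 \<in> ppca_params"
    and "prob_space.indep_vars M (\<lambda>_. borel) X {1..}"
    and "\<And>i. i \<ge> 1 \<Longrightarrow> distributed M lborel (X i) (\<lambda>x. ennreal (ppca_density \<theta>\<^sub>0 x))"
    and "AE \<omega> in M. \<forall>n\<ge>1. (\<exists>\<phi> :: (real^'q^'p) \<times> real. is_ppca_mle (\<lambda>i. X i \<omega>) n \<phi>)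
                            \<longrightarrow> is_ppca_mle (\<lambda>i. X i \<omega>) n (\<theta> n \<omega>)"
  shows "(AE \<omega> in M.
            limitin (collapse_topology ppca_params (ppca_fiber \<theta>\<^sub>0))
              (\<lambda>n. collapse_class ppca_params (ppca_fiber \<theta>\<^sub>0) (\<theta> n \<omega>))
              (collapse_class ppca_params (ppca_fiber \<theta>\<^sub>0) \<theta>\<^sub>0) sequentially)
       \<and> (\<forall>\<epsilon>>0.
            (\<lambda>n. outer_measure_of M {\<omega> \<in> space M.
               collapse_dist (ppca_fiber \<theta>\<^sub>0)
                 (collapse_class ppca_params (ppca_fiber \<theta>\<^sub>0) (\<theta> n \<omega>))
                 (collapse_class ppca_params (ppca_fiber \<theta>\<^sub>0) \<theta>\<^sub>0) > \<epsilon>})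
            \<longlonglongrightarrow> 0)"
proof -
  interpret prob_space M by fact
  interpret Q: Metric_space "ppca_params // collapse_rel ppca_params (ppca_fiber \<theta>\<^sub>0)"
    "collapse_dist (ppca_fiber \<theta>\<^sub>0)"
    by (rule Metric_space_ppca_quotient[OF assms(3)])
  define cls where "cls = collapse_class ppca_params (ppca_fiber \<theta>\<^sub>0)"
  define S where "S = ppca_cov \<theta>\<^sub>0"
  define E where "E \<delta> n = {\<omega> \<in> space M. \<exists>a b. \<delta> \<le> \<bar>sample_cov (\<lambda>i. X i \<omega>) n $ a $ b - S $ a $ b\<bar>}" for \<delta> n
  define good where "good \<omega> \<longleftrightarrow> (\<forall>n\<ge>1. (\<exists>\<phi> :: (real^'q^'p) \<times> real. is_ppca_mle (\<lambda>i. X i \<omega>) n \<phi>)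
                            \<longrightarrow> is_ppca_mle (\<lambda>i. X i \<omega>) n (\<theta> n \<omega>))" for \<omega>
  have S: "pos_def S" unfolding S_def by (rule ppca_cov_pos_def[OF assms(3)])
  have D: "distributed M lborel (X i) (\<lambda>x. ennreal (mvn_density 0 S x))" if "i \<ge> 1" for i
    using assms(5)[OF that] by (simp add: ppca_density_def S_def)
  note E_sets = sets_sample_cov_deviation[OF S assms(4) D, folded E_def]
  note E_summable = summable_sample_cov_deviation[OF S assms(4) D, folded E_def]
  \<comment> \<open>Membership in \<open>ppca_params\<close> is part of the claim:
    \<open>limitin\<close> asks for points eventually in the quotient, and
    \<open>\<theta> n \<omega>\<close> is unconstrained where no maximiser exists.\<close>
  have "\<exists>\<delta>>0. \<forall>n\<ge>1. \<forall>\<omega>\<in>space M. good \<omega> \<longrightarrow> \<omega> \<notin> E \<delta> n \<longrightarrow>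
      \<theta> n \<omega> \<in> ppca_params \<and> collapse_dist (ppca_fiber \<theta>\<^sub>0) (cls (\<theta> n \<omega>)) (cls \<theta>\<^sub>0) < \<epsilon>"
    if \<epsilon>: "\<epsilon> > 0" for \<epsilon>
  proof -
    obtain \<delta> where \<delta>: "\<delta> > 0"
      and min: "\<And>T. (\<And>i j. \<bar>T $ i $ j - ppca_cov \<theta>\<^sub>0 $ i $ j\<bar> < \<delta>) \<Longrightarrow>
        \<exists>\<theta>::(real^'q^'p) \<times> real. \<theta> \<in> ppca_params \<and>
          (\<forall>\<phi>\<in>ppca_params. ppca_loss T \<theta> \<le> ppca_loss T (\<phi> :: (real^'q^'p) \<times> real))"
      and near: "\<And>T \<theta>. (\<And>i j. \<bar>T $ i $ j - ppca_cov \<theta>\<^sub>0 $ i $ j\<bar> < \<delta>) \<Longrightarrow> \<theta> \<in> ppca_params \<Longrightarrow>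
        ppca_loss T \<theta> \<le> ppca_loss T \<theta>\<^sub>0 \<Longrightarrow> infdist \<theta> (ppca_fiber \<theta>\<^sub>0) < \<epsilon>"
      using ppca_loss_minimizer_near[OF assms(1,3) \<epsilon>] by metis
    have "\<theta> n \<omega> \<in> ppca_params \<and> collapse_dist (ppca_fiber \<theta>\<^sub>0) (cls (\<theta> n \<omega>)) (cls \<theta>\<^sub>0) < \<epsilon>"
      if "n \<ge> 1" "\<omega> \<in> space M" "good \<omega>" "\<omega> \<notin> E \<delta> n" for n \<omega>
    proof -
      define T where "T = sample_cov (\<lambda>i. X i \<omega>) n"
      have T: "\<bar>T $ i $ j - ppca_cov \<theta>\<^sub>0 $ i $ j\<bar> < \<delta>" for i j
        using that(2,4) unfolding E_def T_def S_def by (auto simp: not_le)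
      \<comment> \<open>Existence of a minimiser near the true covariance triggers the conditional
        hypothesis on \<open>\<theta> n \<omega>\<close>; afterwards only the competitor
        \<open>\<theta>\<^sub>0\<close> is used.\<close>
      have "\<exists>\<phi> :: (real^'q^'p) \<times> real. is_ppca_mle (\<lambda>i. X i \<omega>) n \<phi>"
        using min[OF T] unfolding T_def is_ppca_mle_iff[OF that(1)] .
      then have "is_ppca_mle (\<lambda>i. X i \<omega>) n (\<theta> n \<omega>)" using that(1,3) by (auto simp: good_def)
      then have mle: "\<theta> n \<omega> \<in> ppca_params" "ppca_loss T (\<theta> n \<omega>) \<le> ppca_loss T \<theta>\<^sub>0"
        using assms(3) unfolding is_ppca_mle_iff[OF that(1)] T_def by auto
      show ?thesis
        using near[OF T mle] collapse_dist_ppca_fiber_le[OF mle(1) assms(3)] mle(1)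
        unfolding cls_def by linarith
    qed
    then show ?thesis using \<delta> by blast
  qed
  then obtain \<delta> where \<delta>: "\<And>\<epsilon>. \<epsilon> > 0 \<Longrightarrow> \<delta> \<epsilon> > 0"
    and close: "\<And>\<epsilon> n \<omega>. \<epsilon> > 0 \<Longrightarrow> n \<ge> 1 \<Longrightarrow> \<omega> \<in> space M \<Longrightarrow> good \<omega> \<Longrightarrow> \<omega> \<notin> E (\<delta> \<epsilon>) n \<Longrightarrow>
      \<theta> n \<omega> \<in> ppca_params \<and> collapse_dist (ppca_fiber \<theta>\<^sub>0) (cls (\<theta> n \<omega>)) (cls \<theta>\<^sub>0) < \<epsilon>"
    by metis
  have good: "AE \<omega> in M. good \<omega>" using assms(6) unfolding good_def .
  have cls_in: "\<phi> \<in> ppca_params \<Longrightarrow> cls \<phi> \<in> ppca_params // collapse_rel ppca_params (ppca_fiber \<theta>\<^sub>0)"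
    for \<phi> :: "(real^'q^'p) \<times> real"
    unfolding cls_def by (rule quotientI)
  \<comment> \<open>Borel-Cantelli: almost surely only finitely many of the deviation events
    occur.\<close>
  have "AE \<omega> in M. \<forall>\<^sub>F n in sequentially. \<omega> \<in> space M - E \<eta> n" if "\<eta> > 0" for \<eta>
    by (rule borel_cantelli_AE1) (use that E_sets E_summable in \<open>auto simp: less_top[symmetric]\<close>)
  \<comment> \<open>Radii \<open>1 / real (Suc k)\<close> suffice, and being countably many they
    share one exceptional null set.\<close>
  then have "AE \<omega> in M. \<forall>k. \<forall>\<^sub>F n in sequentially. \<omega> \<in> space M - E (\<delta> (1 / real (Suc k))) n"
    unfolding AE_all_countable using \<delta> by simp
  then have "AE \<omega> in M. limitin Q.mtopology (\<lambda>n. cls (\<theta> n \<omega>)) (cls \<theta>\<^sub>0) sequentially"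
    using good AE_space
  proof eventually_elim
    case (elim \<omega>)
    have "\<forall>\<^sub>F n in sequentially. cls (\<theta> n \<omega>) \<in> ppca_params // collapse_rel ppca_params (ppca_fiber \<theta>\<^sub>0)
        \<and> collapse_dist (ppca_fiber \<theta>\<^sub>0) (cls (\<theta> n \<omega>)) (cls \<theta>\<^sub>0) < \<epsilon>" if \<epsilon>: "\<epsilon> > 0" for \<epsilon>
    proof -
      obtain k where k: "1 / real (Suc k) < \<epsilon>" using nat_approx_posE[OF \<epsilon>] by blast
      have "\<forall>\<^sub>F n in sequentially. \<omega> \<in> space M - E (\<delta> (1 / real (Suc k))) n" using elim(1) by blast
      then show ?thesis using eventually_ge_at_top[of 1]
      proof eventually_elim
        case (elim n)
        then have "\<theta> n \<omega> \<in> ppca_params"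
          "collapse_dist (ppca_fiber \<theta>\<^sub>0) (cls (\<theta> n \<omega>)) (cls \<theta>\<^sub>0) < 1 / real (Suc k)"
          using close[of "1 / real (Suc k)" n \<omega>] \<open>good \<omega>\<close> by auto
        then show ?case using cls_in less_trans[OF _ k] by blast
      qed
    qed
    then show ?case unfolding Q.limitin_metric using cls_in[OF assms(3)] by blast
  qed
  moreover have "(\<lambda>n. outer_measure_of M
      {\<omega> \<in> space M. collapse_dist (ppca_fiber \<theta>\<^sub>0) (cls (\<theta> n \<omega>)) (cls \<theta>\<^sub>0) > \<epsilon>}) \<longlonglongrightarrow> 0" if "\<epsilon> > 0" for \<epsilon>
  proof -
    \<comment> \<open>The failure set of \<open>good\<close> need not be measurable, so it is
      covered by a measurable null set. Together with the deviation event this gives a measurable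
      cover of the event in question, whose measure is the probability of the deviation.\<close>
    obtain N where N: "{\<omega> \<in> space M. \<not> good \<omega>} \<subseteq> N" "N \<in> null_sets M"
      using good by (auto elim!: AE_E simp: null_sets_def)
    have Es: "E (\<delta> \<epsilon>) n \<in> events" for n using E_sets \<delta>[OF that] by blast
    have "outer_measure_of M {\<omega> \<in> space M. collapse_dist (ppca_fiber \<theta>\<^sub>0) (cls (\<theta> n \<omega>)) (cls \<theta>\<^sub>0) > \<epsilon>}
        \<le> ennreal (prob (E (\<delta> \<epsilon>) n))" if n: "n \<ge> 1" for n
    proof -
      have "{\<omega> \<in> space M. collapse_dist (ppca_fiber \<theta>\<^sub>0) (cls (\<theta> n \<omega>)) (cls \<theta>\<^sub>0) > \<epsilon>} \<subseteq> E (\<delta> \<epsilon>) n \<union> N"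
      proof
        fix \<omega> assume \<omega>: "\<omega> \<in> {\<omega> \<in> space M. collapse_dist (ppca_fiber \<theta>\<^sub>0) (cls (\<theta> n \<omega>)) (cls \<theta>\<^sub>0) > \<epsilon>}"
        show "\<omega> \<in> E (\<delta> \<epsilon>) n \<union> N"
        proof (rule ccontr)
          assume "\<omega> \<notin> E (\<delta> \<epsilon>) n \<union> N"
          then show False using close[OF \<open>\<epsilon> > 0\<close> n, of \<omega>] \<omega> N(1) by auto
        qed
      qed
      then have "outer_measure_of M {\<omega> \<in> space M. collapse_dist (ppca_fiber \<theta>\<^sub>0) (cls (\<theta> n \<omega>)) (cls \<theta>\<^sub>0) > \<epsilon>}
          \<le> outer_measure_of M (E (\<delta> \<epsilon>) n \<union> N)"
        by (rule outer_measure_of_mono)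
      also have "\<dots> = emeasure M (E (\<delta> \<epsilon>) n \<union> N)"
        using Es N(2) by (intro outer_measure_of_eq) auto
      also have "\<dots> = ennreal (prob (E (\<delta> \<epsilon>) n))"
        using emeasure_Un_null_set[OF Es N(2)] by (simp add: emeasure_eq_measure)
      finally show ?thesis .
    qed
    then have le: "\<forall>\<^sub>F n in sequentially. outer_measure_of M
        {\<omega> \<in> space M. collapse_dist (ppca_fiber \<theta>\<^sub>0) (cls (\<theta> n \<omega>)) (cls \<theta>\<^sub>0) > \<epsilon>} \<le> ennreal (prob (E (\<delta> \<epsilon>) n))"
      by (rule eventually_sequentiallyI)
    have "(\<lambda>n. prob (E (\<delta> \<epsilon>) n)) \<longlonglongrightarrow> 0"
      using E_summable[OF _ \<delta>[OF that]] by (intro summable_LIMSEQ_zero) auto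
    then have lim: "(\<lambda>n. ennreal (prob (E (\<delta> \<epsilon>) n))) \<longlonglongrightarrow> 0"
      using tendsto_ennrealI by fastforce
    show ?thesis by (rule tendsto_sandwich[OF _ le tendsto_const lim]) simp
  qed
  ultimately show ?thesis unfolding cls_def by blast
qed

end
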